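(* Let $\mathcal{C}\subset\mathbb{R}^n$ be $\alpha$-prox-regular for some $\alpha>0$. Let $\Phi:\mathbb{R}^n\to\mathbb{R}$ be continuously differentiable in a neighborhood of $\mathcal{C}$ and such that the sublevel sets $\mathcal{S}_{\ell'}:=\{x\in\mathcal{C}\mid \Phi(x)\le \ell'\}$ are compact for all $\ell'\in\mathbb{R}$. Let $\ell\in\mathbb{R}$ be given and define $$\mathcal{C}_\ell:=\left\{x\in\mathcal{C}+\tfrac{1}{2\alpha}\operatorname{int}\mathbb{B}\ \middle|\ P_{\mathcal{C}}(x)\in\mathcal{S}_\ell\right\}.$$ Then there exists $K^\star>0$ such that for all $K\in(0,K^\star)$ and all initial conditions $x(0)\in\mathcal{C}_\ell$ the inclusion $$\dot x\in F(x):=-\nabla\Phi(P_{\mathcal{C}}(x))-\tfrac1K\left(x-P_{\mathcal{C}}(x)\right)$$ admits a complete solution $x:[0,\infty)\to\mathcal{C}_\ell$. Further, for any such solution, the projected trajectory $\overline{x}:=P_{\mathcal{C}}\circ x$ converges (as $t\to\infty$) to the set of critical points of the problem: minimize $\Phi(x)$ subject to $x\in\mathcal{C}$.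
   Context: $\mathbb{R}^n$ carries the usual inner product and 2-norm; $\operatorname{int}\mathbb{B}$ is the open unit ball. $d_{\mathcal{C}}(x):=\inf_{\tilde x\in\mathcal{C}}\|x-\tilde x\|$ and $P_{\mathcal{C}}(x):=\{\tilde x\in\mathcal{C}\mid \|x-\tilde x\|=d_{\mathcal{C}}(x)\}$. $T_x\mathcal{C}$ is the (Bouligand) tangent cone of $\mathcal{C}$ at $x\in\mathcal{C}$. $\mathcal{C}$ is Clarke regular if it is closed and $x\mapsto T_x\mathcal{C}$ is inner semicontinuous; then $N_x\mathcal{C}$ denotes the normal cone, i.e., the polar cone of $T_x\mathcal{C}$. Given $\alpha>0$, a Clarke regular set $\mathcal{C}$ is $\alpha$-prox-regular if for every $x\in\mathcal{C}$ and every $\eta\in N_x\mathcal{C}$ one has $\langle\eta,y-x\rangle\le\alpha\|\eta\|\|y-x\|^2$ for all $y\in\mathcal{C}$. It is known that if $\mathcal{C}$ is $\alpha$-prox-regular then $P_{\mathcal{C}}$ is single-valued on $\mathcal{C}+\frac{1}{2\alpha}\operatorname{int}\mathbb{B}$, so $F$ is single-valued there (where $P_{\mathcal{C}}(x)$ is not a singleton, $F(x)=\{-\nabla\Phi(p)-\frac1K(x-p)\mid p\in P_{\mathcal{C}}(x)\}$). A solution of $\dot x\in F(x)$ on $[0,T]$, $T>0$, is an absolutely continuous map with $\dot x(t)\in F(x(t))$ for almost all $t\in[0,T]$; a complete solution is a map $x:[0,\infty)\to\mathbb{R}^n$ whose restriction to every compact subinterval $[0,T]$ is a solution. A point $x^\star\in\mathcal{C}$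 is a critical point of the problem "minimize $\Phi(x)$ subject to $x\in\mathcal{C}$" if $\nabla\Phi(x^\star)\in-N_{x^\star}\mathcal{C}$. Convergence of a trajectory to a set means that its distance to the set tends to zero as $t\to\infty$. *)

theory Defs
  imports "HOL-Analysis.Analysis"
begin

text \<open>The library function \<^const>\<open>infdist\<close> is the distance to a set; it takes the value 0
  on the empty set, which is harmless in \<open>proj_set\<close> and is excluded in \<open>converges_to_set\<close>.\<close>

definition proj_set :: "'a::euclidean_space set \<Rightarrow> 'a \<Rightarrow> 'a set" where
  "proj_set C x = {y \<in> C. norm (x - y) = infdist x C}"

definition tangent_cone :: "'a::euclidean_space set \<Rightarrow> 'a \<Rightarrow> 'a set" where
  "tangent_cone C x =
     {v. \<exists>(y :: nat \<Rightarrow> 'a) (d :: nat \<Rightarrow> real).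
           (\<forall>k. y k \<in> C) \<and> y \<longlonglongrightarrow> x \<and>
           (\<forall>k. 0 < d k) \<and> d \<longlonglongrightarrow> 0 \<and>
           (\<lambda>k. (y k - x) /\<^sub>R d k) \<longlonglongrightarrow> v}"

text \<open>Inner semicontinuity of the set-valued map \<open>S\<close> at every point of \<open>C\<close>, relative to \<open>C\<close>.\<close>

definition inner_semicontinuous_on ::
    "'a::euclidean_space set \<Rightarrow> ('a \<Rightarrow> 'b::euclidean_space set) \<Rightarrow> bool" where
  "inner_semicontinuous_on C S \<longleftrightarrow>
     (\<forall>x\<in>C. \<forall>v\<in>S x. \<forall>y :: nat \<Rightarrow> 'a.
        (\<forall>k. y k \<in> C) \<and> y \<longlonglongrightarrow> x \<longrightarrow>
        (\<exists>w. (\<forall>\<^sub>F k in sequentially. w k \<in> S (y k)) \<and> w \<longlonglongrightarrow> v))"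

definition clarke_regular :: "'a::euclidean_space set \<Rightarrow> bool" where
  "clarke_regular C \<longleftrightarrow> closed C \<and> inner_semicontinuous_on C (tangent_cone C)"

definition normal_cone :: "'a::euclidean_space set \<Rightarrow> 'a \<Rightarrow> 'a set" where
  "normal_cone C x = {\<eta>. \<forall>v\<in>tangent_cone C x. \<eta> \<bullet> v \<le> 0}"

definition prox_regular :: "real \<Rightarrow> 'a::euclidean_space set \<Rightarrow> bool" where
  "prox_regular \<alpha> C \<longleftrightarrow>
     clarke_regular C \<and>
     (\<forall>x\<in>C. \<forall>\<eta>\<in>normal_cone C x. \<forall>y\<in>C.
        \<eta> \<bullet> (y - x) \<le> \<alpha> * norm \<eta> * (norm (y - x))\<^sup>2)"

definition gradient :: "('a::euclidean_space \<Rightarrow> real) \<Rightarrow> 'a \<Rightarrow> 'a" where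
  "gradient f x = (THE D. GDERIV f x :> D)"

definition continuously_differentiable_near ::
    "'a::euclidean_space set \<Rightarrow> ('a \<Rightarrow> real) \<Rightarrow> bool" where
  "continuously_differentiable_near C f \<longleftrightarrow>
     (\<exists>U. open U \<and> C \<subseteq> U \<and> (\<forall>x\<in>U. \<exists>D. GDERIV f x :> D) \<and>
          continuous_on U (gradient f))"

definition sublevel_set ::
    "'a::euclidean_space set \<Rightarrow> ('a \<Rightarrow> real) \<Rightarrow> real \<Rightarrow> 'a set" where
  "sublevel_set C f l = {x \<in> C. f x \<le> l}"

definition critical_points ::
    "'a::euclidean_space set \<Rightarrow> ('a \<Rightarrow> real) \<Rightarrow> 'a set" where
  "critical_points C f = {x \<in> C. gradient f x \<in> uminus ` normal_cone C x}"

definition open_tube :: "'a::euclidean_space set \<Rightarrow> real \<Rightarrow> 'a set" where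
  "open_tube C r = {c + r *\<^sub>R b | c b. c \<in> C \<and> b \<in> ball 0 1}"

text \<open>The condition that the single-valued projection of \<open>x\<close> lies in the sublevel set is
  expressed by the set \<open>proj_set C x\<close> being the singleton of a point of that sublevel set.\<close>

definition tube_sublevel ::
    "real \<Rightarrow> 'a::euclidean_space set \<Rightarrow> ('a \<Rightarrow> real) \<Rightarrow> real \<Rightarrow> 'a set" where
  "tube_sublevel \<alpha> C f l =
     {x \<in> open_tube C (1 / (2 * \<alpha>)). \<exists>p \<in> sublevel_set C f l. proj_set C x = {p}}"

definition antiwindup_field ::
    "'a::euclidean_space set \<Rightarrow> ('a \<Rightarrow> real) \<Rightarrow> real \<Rightarrow> 'a \<Rightarrow> 'a set" where
  "antiwindup_field C f K x = {- gradient f p - (1 / K) *\<^sub>R (x - p) | p. p \<in> proj_set C x}"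

definition absolutely_continuous_on ::
    "real set \<Rightarrow> (real \<Rightarrow> 'a::euclidean_space) \<Rightarrow> bool" where
  "absolutely_continuous_on S x \<longleftrightarrow>
     (\<forall>\<epsilon>>0. \<exists>\<delta>>0. \<forall>(n :: nat) a b.
        (\<forall>i<n. a i < b i \<and> {a i..b i} \<subseteq> S) \<and>
        (\<forall>i<n. \<forall>j<n. i \<noteq> j \<longrightarrow> {a i<..<b i} \<inter> {a j<..<b j} = {}) \<and>
        (\<Sum>i<n. b i - a i) < \<delta> \<longrightarrow>
        (\<Sum>i<n. norm (x (b i) - x (a i))) < \<epsilon>)"

definition inclusion_solution ::
    "('a::euclidean_space \<Rightarrow> 'a set) \<Rightarrow> real \<Rightarrow> (real \<Rightarrow> 'a) \<Rightarrow> bool" where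
  "inclusion_solution F T x \<longleftrightarrow>
     absolutely_continuous_on {0..T} x \<and>
     (AE t in lebesgue_on {0..T}.
        \<exists>v \<in> F (x t). (x has_vector_derivative v) (at t within {0..T}))"

text \<open>A map on the half-line is represented by a total function on the reals; only its
  values at nonnegative times matter below.\<close>

definition complete_solution ::
    "('a::euclidean_space \<Rightarrow> 'a set) \<Rightarrow> (real \<Rightarrow> 'a) \<Rightarrow> bool" where
  "complete_solution F x \<longleftrightarrow> (\<forall>T>0. inclusion_solution F T x)"

definition converges_to_set ::
    "(real \<Rightarrow> 'a::euclidean_space) \<Rightarrow> 'a set \<Rightarrow> bool" where
  "converges_to_set x A \<longleftrightarrow> A \<noteq> {} \<and> ((\<lambda>t. infdist (x t) A) \<longlongrightarrow> 0) at_top"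

text \<open>The projection of a trajectory, meaningful where \<open>proj_set C (x t)\<close> is a singleton.\<close>

definition projected_trajectory ::
    "'a::euclidean_space set \<Rightarrow> (real \<Rightarrow> 'a) \<Rightarrow> real \<Rightarrow> 'a" where
  "projected_trajectory C x t = the_elem (proj_set C (x t))"

end

theory Submission
  imports Defs "HOL-Complex_Analysis.Great_Picard"
begin

text \<open>Write \<open>p = proj C x\<close> and \<open>\<eta> = x - p\<close>, a proximal normal at \<open>p\<close>. If \<open>norm (gradient f) \<le> M\<close> on the
  sublevel set, the distance to \<open>C\<close> decreases whenever it exceeds \<open>K * M\<close>, so for
  \<open>K * M < 1 / (2 * \<alpha>)\<close> a solution keeps a distance at most some \<open>R < 1 / (2 * \<alpha>)\<close> from \<open>C\<close>.
  Along a solution \<open>gradient f p = - x' - \<eta> / K\<close>, where \<open>\<eta>\<close> is orthogonal to the motion of \<open>p\<close> up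
  to second order, while the projection is strongly monotone with constant \<open>c = 1 - 2 * \<alpha> * R\<close> by
  prox-regularity. Hence
  \<open>f (p b) - f (p a) \<le> - c * (norm (p b - p a))\<^sup>2 / (b - a)\<close>; this is obtained from difference
  quotients, so that neither differentiability of \<open>p\<close> nor a tangent cone calculus is needed.

  Existence follows from Peano's theorem for a bounded continuous extension of the field, because the
  two estimates confine the solution. Since \<open>f \<circ> p\<close> converges, \<open>p\<close> varies arbitrarily slowly for
  large times, and \<open>x\<close>, being an exponentially relaxing filter of \<open>p - K *\<^sub>R gradient f p\<close>,
  satisfies \<open>\<eta> + K *\<^sub>R gradient f p \<longlonglongrightarrow> 0\<close>. The prox-regularity inequality for \<open>\<eta>\<close> passes to the
  limit and shows that every limit point of \<open>p\<close> is critical.\<close>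

section \<open>Projections onto prox-regular sets\<close>

text \<open>The value is meaningful only where \<open>proj_set C x\<close> is a singleton. The body
  is that of \<open>projected_trajectory\<close>, so the two can be exchanged at the end.\<close>

definition proj :: "'a::euclidean_space set \<Rightarrow> 'a \<Rightarrow> 'a" where
  "proj C x = the_elem (proj_set C x)"

text \<open>Dividing by \<open>d k\<close> turns the quadratic bound into a bounded quotient times
  \<open>norm (y k - p)\<close>, which tends to 0. Any constant \<open>c\<close> therefore yields a
  normal vector; this is the only access to \<open>normal_cone\<close> from proximal
  inequalities.\<close>

lemma normal_coneI:
  fixes C :: "'a::euclidean_space set"
  assumes "\<And>y. y \<in> C \<Longrightarrow> \<eta> \<bullet> (y - p) \<le> c * (norm (y - p))\<^sup>2"
  shows "\<eta> \<in> normal_cone C p"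
  unfolding normal_cone_def
proof (intro CollectI ballI)
  fix v assume "v \<in> tangent_cone C p"
  then obtain y d where yC: "\<And>k. y k \<in> C" and y: "y \<longlonglongrightarrow> p" and d0: "\<And>k::nat. 0 < d k"
    and v: "(\<lambda>k. (y k - p) /\<^sub>R d k) \<longlonglongrightarrow> v"
    unfolding tangent_cone_def by auto
  have "(\<lambda>k. c * (norm (y k - p) * norm ((y k - p) /\<^sub>R d k))) \<longlonglongrightarrow> c * (norm (p - p) * norm v)"
    by (intro tendsto_intros y v)
  moreover have "(\<lambda>k. \<eta> \<bullet> ((y k - p) /\<^sub>R d k)) \<longlonglongrightarrow> \<eta> \<bullet> v"
    by (intro tendsto_intros v)
  moreover have "\<eta> \<bullet> ((y k - p) /\<^sub>R d k) \<le> c * (norm (y k - p) * norm ((y k - p) /\<^sub>R d k))" for k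
  proof -
    have "(\<eta> \<bullet> (y k - p)) / d k \<le> (c * (norm (y k - p))\<^sup>2) / d k"
      using assms[OF yC] d0[of k] by (intro divide_right_mono) auto
    then show ?thesis
      using d0[of k] by (simp add: power2_eq_square divide_inverse mult_ac)
  qed
  ultimately show "\<eta> \<bullet> v \<le> 0"
    using LIMSEQ_le by fastforce
qed

lemma proj_set_nonempty:
  assumes "closed C" "C \<noteq> {}"
  shows "proj_set C x \<noteq> {}"
  using infdist_attains_inf[OF assms, of x]
  unfolding proj_set_def by (metis (mono_tags, lifting) dist_norm empty_iff mem_Collect_eq)

text \<open>Minimality of the distance, after squaring and expanding, is a proximal inequality with
  constant \<open>1/2\<close>.\<close>

lemma proj_set_in_normal_cone:
  assumes "p \<in> proj_set C x"
  shows "x - p \<in> normal_cone C p"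
proof (rule normal_coneI)
  fix y assume "y \<in> C"
  then have "norm (x - p) \<le> norm (x - y)"
    using assms infdist_le[of y C x] by (auto simp: proj_set_def dist_norm)
  then have "(x - p) \<bullet> (x - p) \<le> (x - y) \<bullet> (x - y)"
    by (simp add: norm_le)
  then show "(x - p) \<bullet> (y - p) \<le> 1/2 * (norm (y - p))\<^sup>2"
    by (simp add: power2_norm_eq_inner inner_commute algebra_simps)
qed

lemma open_tube_infdist:
  assumes "x \<in> open_tube C r" "0 < r"
  shows "infdist x C < r" "C \<noteq> {}"
proof -
  obtain c b where x: "x = c + r *\<^sub>R b" and c: "c \<in> C" and b: "norm b < 1"
    using assms(1) by (auto simp: open_tube_def)
  have "infdist x C \<le> dist x c"
    using c by (rule infdist_le)
  also have "\<dots> < r"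
    using x b assms(2) by (simp add: dist_norm)
  finally show "infdist x C < r" .
  show "C \<noteq> {}" using c by auto
qed

lemma in_open_tubeI:
  assumes "c \<in> C" "norm (x - c) < r"
  shows "x \<in> open_tube C r"
proof -
  have "0 < r" using assms(2) norm_ge_zero le_less_trans by blast
  then have "x = c + r *\<^sub>R ((x - c) /\<^sub>R r)" "norm ((x - c) /\<^sub>R r) < 1"
    using assms(2) by (auto simp: divide_simps)
  then show ?thesis
    using assms(1) unfolding open_tube_def mem_ball dist_0_norm mem_Collect_eq by blast
qed

section \<open>Monotonicity, uniqueness and continuity of the projection\<close>

locale prox_regular_set =
  fixes C :: "'a::euclidean_space set" and \<alpha> :: real
  assumes alpha_pos: "0 < \<alpha>" and prox: "prox_regular \<alpha> C" and nonempty: "C \<noteq> {}"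
begin

lemma closed_C: "closed C"
  using prox by (auto simp: prox_regular_def clarke_regular_def)

lemma normal_cone_prox:
  assumes "p \<in> C" "\<eta> \<in> normal_cone C p" "y \<in> C"
  shows "\<eta> \<bullet> (y - p) \<le> \<alpha> * norm \<eta> * (norm (y - p))\<^sup>2"
  using prox assms by (auto simp: prox_regular_def)

text \<open>The residual \<open>x - p\<close> is a normal vector of norm \<open>infdist x C\<close>,
  so the curvature constant shrinks with the distance to \<open>C\<close>.\<close>

lemma proj_set_prox:
  assumes "p \<in> proj_set C x" "y \<in> C"
  shows "(x - p) \<bullet> (y - p) \<le> \<alpha> * infdist x C * (norm (y - p))\<^sup>2"
  using normal_cone_prox[OF _ proj_set_in_normal_cone[OF assms(1)] assms(2)] assms(1)
  by (auto simp: proj_set_def)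

text \<open>The proximal inequalities at \<open>p\<close> and at \<open>q\<close>, each tested with
  the other point, are added; splitting \<open>x - y = (x - p) - (y - q) + (p - q)\<close> produces
  the leading square.\<close>

lemma proj_set_hypomonotone:
  assumes p: "p \<in> proj_set C x" and q: "q \<in> proj_set C y"
  shows "(1 - \<alpha> * (infdist x C + infdist y C)) * (norm (p - q))\<^sup>2 \<le> (x - y) \<bullet> (p - q)"
proof -
  have "p \<in> C" "q \<in> C" using p q by (auto simp: proj_set_def)
  then have "(x - p) \<bullet> (q - p) \<le> \<alpha> * infdist x C * (norm (p - q))\<^sup>2"
    "(y - q) \<bullet> (p - q) \<le> \<alpha> * infdist y C * (norm (p - q))\<^sup>2"
    using proj_set_prox[OF p] proj_set_prox[OF q] by (metis norm_minus_commute)+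
  then show ?thesis
    by (simp add: power2_norm_eq_inner inner_commute algebra_simps)
qed

lemma proj_set_lipschitz:
  assumes p: "p \<in> proj_set C x" and q: "q \<in> proj_set C y"
    and "0 < c" "c \<le> 1 - \<alpha> * (infdist x C + infdist y C)"
  shows "norm (p - q) \<le> norm (x - y) / c"
proof (cases "p = q")
  case False
  have "c * (norm (p - q))\<^sup>2 \<le> (1 - \<alpha> * (infdist x C + infdist y C)) * (norm (p - q))\<^sup>2"
    using assms(4) by (rule mult_right_mono) auto
  also have "\<dots> \<le> (x - y) \<bullet> (p - q)"
    by (rule proj_set_hypomonotone[OF p q])
  also have "\<dots> \<le> norm (x - y) * norm (p - q)"
    by (rule norm_cauchy_schwarz)
  finally have "c * norm (p - q) \<le> norm (x - y)"
    using False by (simp add: power2_eq_square)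
  then show ?thesis
    using \<open>0 < c\<close> by (simp add: field_simps)
qed (use \<open>0 < c\<close> in auto)

text \<open>The Lipschitz estimate between two projections of the same point gives uniqueness; its
  constant is positive exactly below the radius \<open>1 / (2 * \<alpha>)\<close>.\<close>

lemma proj_set_eq:
  assumes "infdist x C < 1 / (2 * \<alpha>)"
  shows "proj_set C x = {proj C x}"
proof -
  obtain p where p: "p \<in> proj_set C x"
    using proj_set_nonempty[OF closed_C nonempty] by auto
  have "q = p" if "q \<in> proj_set C x" for q
  proof -
    have "0 < 1 - \<alpha> * (infdist x C + infdist x C)"
      using assms alpha_pos by (simp add: field_simps)
    from proj_set_lipschitz[OF that p this] show ?thesis by simp
  qed
  then have "proj_set C x = {p}" using p by blast
  then show ?thesis by (simp add: proj_def)
qed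

lemma proj_in:
  assumes "infdist x C < 1 / (2 * \<alpha>)"
  shows "proj C x \<in> proj_set C x" "proj C x \<in> C" "norm (x - proj C x) = infdist x C"
proof -
  show "proj C x \<in> proj_set C x"
    unfolding proj_set_eq[OF assms] by simp
  then show "proj C x \<in> C" "norm (x - proj C x) = infdist x C"
    unfolding proj_set_def by blast+
qed

lemma continuous_on_proj: "continuous_on {x. infdist x C < 1 / (2 * \<alpha>)} (proj C)"
  unfolding continuous_on_def
proof
  fix x assume "x \<in> {x. infdist x C < 1 / (2 * \<alpha>)}"
  then have x: "infdist x C < 1 / (2 * \<alpha>)" by simp
  \<comment> \<open>Half of the monotonicity constant at \<open>x\<close>: by continuity of the
    distance it is still an admissible constant for all \<open>y\<close> near
    \<open>x\<close>.\<close>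
  define c where "c = (1 - 2 * \<alpha> * infdist x C) / 2"
  let ?F = "at x within {x. infdist x C < 1 / (2 * \<alpha>)}"
  have c: "0 < c" using x alpha_pos by (simp add: c_def field_simps)
  have lim: "((\<lambda>y. 1 - \<alpha> * (infdist y C + infdist x C)) \<longlongrightarrow> 1 - \<alpha> * (infdist x C + infdist x C)) ?F"
    by (intro tendsto_intros)
  have "c < 1 - \<alpha> * (infdist x C + infdist x C)" using c by (simp add: c_def field_simps)
  from order_tendstoD(1)[OF lim this]
  have "\<forall>\<^sub>F y in ?F. c < 1 - \<alpha> * (infdist y C + infdist x C)" .
  moreover have "\<forall>\<^sub>F y in ?F. y \<in> {x. infdist x C < 1 / (2 * \<alpha>)}"
    by (simp add: eventually_at_filter)
  ultimately have "\<forall>\<^sub>F y in ?F. dist (proj C y) (proj C x) \<le> dist y x / c"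
  proof eventually_elim
    case (elim y)
    then show ?case
      using proj_set_lipschitz[OF proj_in(1) proj_in(1)[OF x] c, of y] by (simp add: dist_norm)
  qed
  moreover have "((\<lambda>y. dist y x / c) \<longlongrightarrow> dist x x / c) ?F"
    by (intro tendsto_intros) (use c in auto)
  then have "((\<lambda>y. dist y x / c) \<longlongrightarrow> 0) ?F" by simp
  ultimately have "((\<lambda>y. dist (proj C y) (proj C x)) \<longlongrightarrow> 0) ?F"
    by (rule tendsto_sandwich[rotated 1, OF _ tendsto_const]) simp_all
  then show "(proj C \<longlongrightarrow> proj C x) ?F"
    by (rule tendsto_dist_iff[THEN iffD2])
qed

end

section \<open>Absolutely continuous functions\<close>

lemma lipschitz_from_vector_derivative:
  fixes y :: "real \<Rightarrow> 'a::real_normed_vector"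
  assumes "convex S" "\<And>t. t \<in> S \<Longrightarrow> (y has_vector_derivative v t) (at t within S)"
    and "\<And>t. t \<in> S \<Longrightarrow> norm (v t) \<le> B" "s \<in> S" "t \<in> S"
  shows "norm (y t - y s) \<le> B * \<bar>t - s\<bar>"
proof -
  have "norm (y t - y s) \<le> B * norm (t - s)"
  proof (rule differentiable_bound[OF assms(1)])
    fix u assume "u \<in> S"
    then show "(y has_derivative (\<lambda>h. h *\<^sub>R v u)) (at u within S)"
      using assms(2) by (simp add: has_vector_derivative_def)
    show "onorm (\<lambda>h. h *\<^sub>R v u) \<le> B"
      using assms(3)[OF \<open>u \<in> S\<close>] by (intro onorm_le) (simp add: mult.commute[of B] mult_left_mono)
  qed (use assms in auto)
  then show ?thesis by simp
qed

lemma absolutely_continuous_on_lipschitz: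
  assumes lip: "\<And>s t. s \<in> S \<Longrightarrow> t \<in> S \<Longrightarrow> norm (x t - x s) \<le> B * \<bar>t - s\<bar>"
  shows "absolutely_continuous_on S x"
  unfolding absolutely_continuous_on_def
proof (intro allI impI)
  fix e :: real assume "e > 0"
  \<comment> \<open>\<open>B\<close> may be zero or negative (for instance on an empty set), so a
    positive constant dominating it is used for the division.\<close>
  let ?B = "\<bar>B\<bar> + 1"
  show "\<exists>\<delta>>0. \<forall>(n :: nat) a b.
        (\<forall>i<n. a i < b i \<and> {a i..b i} \<subseteq> S) \<and>
        (\<forall>i<n. \<forall>j<n. i \<noteq> j \<longrightarrow> {a i<..<b i} \<inter> {a j<..<b j} = {}) \<and>
        (\<Sum>i<n. b i - a i) < \<delta> \<longrightarrow>
        (\<Sum>i<n. norm (x (b i) - x (a i))) < e"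
  proof (intro exI conjI allI impI)
    show "e / ?B > 0" using \<open>e > 0\<close> by (simp add: field_simps)
    fix n :: nat and a b :: "nat \<Rightarrow> real"
    assume *: "(\<forall>i<n. a i < b i \<and> {a i..b i} \<subseteq> S) \<and>
        (\<forall>i<n. \<forall>j<n. i \<noteq> j \<longrightarrow> {a i<..<b i} \<inter> {a j<..<b j} = {}) \<and>
        (\<Sum>i<n. b i - a i) < e / ?B"
    have "(\<Sum>i<n. norm (x (b i) - x (a i))) \<le> (\<Sum>i<n. ?B * (b i - a i))"
    proof (rule sum_mono)
      fix i assume "i \<in> {..<n}"
      then have "a i < b i" "{a i..b i} \<subseteq> S" using * by auto
      then have "norm (x (b i) - x (a i)) \<le> B * \<bar>b i - a i\<bar>"
        by (intro lip) auto
      also have "\<dots> \<le> ?B * (b i - a i)"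
        using \<open>a i < b i\<close> by (auto intro!: mult_right_mono)
      finally show "norm (x (b i) - x (a i)) \<le> ?B * (b i - a i)" .
    qed
    also have "\<dots> = ?B * (\<Sum>i<n. b i - a i)"
      by (simp add: sum_distrib_left)
    also have "\<dots> < e"
      using * by (simp add: field_simps)
    finally show "(\<Sum>i<n. norm (x (b i) - x (a i))) < e" .
  qed
qed

lemma absolutely_continuous_on_diff:
  assumes "absolutely_continuous_on S x" "absolutely_continuous_on S y"
  shows "absolutely_continuous_on S (\<lambda>t. x t - y t)"
  unfolding absolutely_continuous_on_def
proof (intro allI impI)
  fix e :: real assume "e > 0"
  then have "e / 2 > 0" by simp
  then obtain d1 where d1: "d1 > 0" "\<And>(n :: nat) a b.
        (\<forall>i<n. a i < b i \<and> {a i..b i} \<subseteq> S) \<and>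
        (\<forall>i<n. \<forall>j<n. i \<noteq> j \<longrightarrow> {a i<..<b i} \<inter> {a j<..<b j} = {}) \<and>
        (\<Sum>i<n. b i - a i) < d1 \<Longrightarrow>
        (\<Sum>i<n. norm (x (b i) - x (a i))) < e / 2"
    using assms(1) unfolding absolutely_continuous_on_def by blast
  obtain d2 where d2: "d2 > 0" "\<And>(n :: nat) a b.
        (\<forall>i<n. a i < b i \<and> {a i..b i} \<subseteq> S) \<and>
        (\<forall>i<n. \<forall>j<n. i \<noteq> j \<longrightarrow> {a i<..<b i} \<inter> {a j<..<b j} = {}) \<and>
        (\<Sum>i<n. b i - a i) < d2 \<Longrightarrow>
        (\<Sum>i<n. norm (y (b i) - y (a i))) < e / 2"
    using assms(2) \<open>e / 2 > 0\<close> unfolding absolutely_continuous_on_def by blast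
  show "\<exists>\<delta>>0. \<forall>(n :: nat) a b.
        (\<forall>i<n. a i < b i \<and> {a i..b i} \<subseteq> S) \<and>
        (\<forall>i<n. \<forall>j<n. i \<noteq> j \<longrightarrow> {a i<..<b i} \<inter> {a j<..<b j} = {}) \<and>
        (\<Sum>i<n. b i - a i) < \<delta> \<longrightarrow>
        (\<Sum>i<n. norm ((x (b i) - y (b i)) - (x (a i) - y (a i)))) < e"
  proof (intro exI conjI allI impI)
    show "min d1 d2 > 0" using d1 d2 by simp
    fix n :: nat and a b :: "nat \<Rightarrow> real"
    assume *: "(\<forall>i<n. a i < b i \<and> {a i..b i} \<subseteq> S) \<and>
        (\<forall>i<n. \<forall>j<n. i \<noteq> j \<longrightarrow> {a i<..<b i} \<inter> {a j<..<b j} = {}) \<and>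
        (\<Sum>i<n. b i - a i) < min d1 d2"
    have "(\<Sum>i<n. norm ((x (b i) - y (b i)) - (x (a i) - y (a i))))
        \<le> (\<Sum>i<n. norm (x (b i) - x (a i)) + norm (y (b i) - y (a i)))"
      by (intro sum_mono) norm
    also have "\<dots> < e / 2 + e / 2"
      unfolding sum.distrib by (intro add_strict_mono d1(2) d2(2)) (use * in auto)
    finally show "(\<Sum>i<n. norm ((x (b i) - y (b i)) - (x (a i) - y (a i)))) < e" by simp
  qed
qed

text \<open>Near a point with zero derivative the increment of \<open>y\<close> is negligible; near an exceptional
  point it is charged to an interval inside an open set of small measure. Bolzano's bisection
  principle glues these local estimates into a finite family of nonoverlapping intervals.\<close>

lemma absolutely_continuous_zero_derivative:
  fixes y :: "real \<Rightarrow> 'a::euclidean_space"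
  assumes ac: "absolutely_continuous_on {0..T} y"
    and ae: "AE t in lebesgue_on {0..T}. (y has_vector_derivative 0) (at t within {0..T})"
    and s: "s \<in> {0..T}"
  shows "y s = y 0"
proof -
  have "AE t in lebesgue. t \<in> {0..T} \<longrightarrow> (y has_vector_derivative 0) (at t within {0..T})"
    using ae by (subst (asm) AE_restrict_space_iff) auto
  then obtain N where N: "{t \<in> space lebesgue. \<not> (t \<in> {0..T} \<longrightarrow> (y has_vector_derivative 0) (at t within {0..T}))} \<subseteq> N"
     "emeasure lebesgue N = 0" "N \<in> sets lebesgue"
    by (rule AE_E)
  \<comment> \<open>The summand \<open>e * s\<close> pays for points with zero derivative, the
    summand \<open>e\<close> for the intervals charged to the exceptional null set.\<close>
  have small: "norm (y s - y 0) \<le> e * s + e" if "e > 0" for e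
  proof -
    obtain \<delta> where \<delta>: "\<delta> > 0" "\<And>(n :: nat) a b.
        (\<forall>i<n. a i < b i \<and> {a i..b i} \<subseteq> {0..T}) \<and>
        (\<forall>i<n. \<forall>j<n. i \<noteq> j \<longrightarrow> {a i<..<b i} \<inter> {a j<..<b j} = {}) \<and>
        (\<Sum>i<n. b i - a i) < \<delta> \<Longrightarrow>
        (\<Sum>i<n. norm (y (b i) - y (a i))) < e"
      using ac \<open>e > 0\<close> unfolding absolutely_continuous_on_def by blast
    obtain G where G: "open G" "N \<subseteq> G" "emeasure lebesgue (G - N) < ennreal \<delta>"
      by (rule sets_lebesgue_outer_open[OF N(3) \<delta>(1)])
    have "G \<in> sets lebesgue" using G(1) by (intro sets_completionI_sets) simp
    have emG: "emeasure lebesgue G < ennreal \<delta>"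
      using G(3) emeasure_Diff_null_set[OF null_setsI[OF N(2,3)] \<open>G \<in> sets lebesgue\<close>] by argo
    have "emeasure lebesgue G < \<infinity>"
      unfolding infinity_ennreal_def by (rule order.strict_trans[OF emG ennreal_less_top])
    with \<open>G \<in> sets lebesgue\<close> have Gm: "G \<in> lmeasurable" by (rule fmeasurableI)
    have mG: "measure lebesgue G < \<delta>"
      using emG[unfolded emeasure_eq_measure2[OF Gm]] by (simp add: ennreal_less_iff)
    \<comment> \<open>\<open>D\<close> is the family of charged intervals, stored as pairs of
      endpoints. Recording that they lie in \<open>[a, b]\<close> keeps the families of adjacent
      intervals nonoverlapping when they are united.\<close>
    define covered where "covered = (\<lambda>a b D. finite D \<and>
        (\<forall>d\<in>D. fst d < snd d \<and> a \<le> fst d \<and> snd d \<le> b \<and> {fst d..snd d} \<subseteq> G) \<and>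
        (\<forall>d\<in>D. \<forall>d'\<in>D. d \<noteq> d' \<longrightarrow> {fst d<..<snd d} \<inter> {fst d'<..<snd d'} = {}) \<and>
        norm (y b - y a) \<le> e * (b - a) + (\<Sum>d\<in>D. norm (y (snd d) - y (fst d))))"
    have "0 \<le> s" "s \<le> T" using s by auto
    \<comment> \<open>The guard in the bisection predicate restricts it to subintervals of
      \<open>[0, T]\<close>, where the derivative is controlled.\<close>
    have "0 \<le> (0::real) \<and> s \<le> T \<longrightarrow> (\<exists>D. covered 0 s D)"
      using \<open>0 \<le> s\<close>
    proof (induction rule: Bolzano[where P = "\<lambda>a b. 0 \<le> a \<and> b \<le> T \<longrightarrow> (\<exists>D. covered a b D)"])
      case (trans a b c)
      show ?case
      proof
        assume "0 \<le> a \<and> c \<le> T"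
        then obtain D E where D: "covered a b D" and E: "covered b c E"
          using trans by force
        have disj: "{fst d<..<snd d} \<inter> {fst d'<..<snd d'} = {}" if "d \<in> D" "d' \<in> E" for d d'
        proof -
          have "snd d \<le> b" "b \<le> fst d'" using D E that by (auto simp: covered_def)
          then show ?thesis by auto
        qed
        have "D \<inter> E = {}"
        proof -
          have False if "d \<in> D" "d \<in> E" for d
          proof -
            have "snd d \<le> b" "b \<le> fst d" "fst d < snd d"
              using D E that unfolding covered_def by blast+
            then show False by linarith
          qed
          then show ?thesis by blast
        qed
        moreover have "finite D" "finite E" using D E by (auto simp: covered_def)
        ultimately have sum: "(\<Sum>d\<in>D \<union> E. norm (y (snd d) - y (fst d))) =
           (\<Sum>d\<in>D. norm (y (snd d) - y (fst d))) + (\<Sum>d\<in>E. norm (y (snd d) - y (fst d)))"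
          by (intro sum.union_disjoint)
        have "norm (y c - y a) \<le> norm (y c - y b) + norm (y b - y a)" by norm
        also have "\<dots> \<le> e * (c - a) + (\<Sum>d\<in>D \<union> E. norm (y (snd d) - y (fst d)))"
          using D E unfolding sum covered_def by (simp add: algebra_simps)
        finally have le: "norm (y c - y a) \<le> e * (c - a) + (\<Sum>d\<in>D \<union> E. norm (y (snd d) - y (fst d)))" .
        have "covered a c (D \<union> E)"
          unfolding covered_def
        proof (intro conjI ballI impI)
          fix d assume d: "d \<in> D \<union> E"
          show "fst d < snd d" "{fst d..snd d} \<subseteq> G"
            using d D E unfolding covered_def by blast+
          have "d \<in> D \<Longrightarrow> a \<le> fst d \<and> snd d \<le> b" "d \<in> E \<Longrightarrow> b \<le> fst d \<and> snd d \<le> c"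
            using D E unfolding covered_def by blast+
          then show "a \<le> fst d" "snd d \<le> c"
            using d trans(3,4) by auto
        next
          fix d d' assume "d \<in> D \<union> E" "d' \<in> D \<union> E" "d \<noteq> d'"
          then consider "d \<in> D" "d' \<in> D" | "d \<in> E" "d' \<in> E" | "d \<in> D" "d' \<in> E" | "d \<in> E" "d' \<in> D"
            by blast
          then show "{fst d<..<snd d} \<inter> {fst d'<..<snd d'} = {}"
          proof cases
            case 1
            then show ?thesis using D \<open>d \<noteq> d'\<close> unfolding covered_def by blast
          next
            case 2
            then show ?thesis using E \<open>d \<noteq> d'\<close> unfolding covered_def by blast
          qed (use disj in blast)+
        qed (use \<open>finite D\<close> \<open>finite E\<close> le in auto)
        then show "\<exists>D. covered a c D" by blast
      qed
    next
      case (local x)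
      show ?case
      proof (cases "x \<in> N")
        case True
        then obtain d where d: "d > 0" "ball x d \<subseteq> G"
          using G(1,2) open_contains_ball by blast
        have "\<exists>D. covered a b D" if "a \<le> x" "x \<le> b" "b - a < d" for a b
        \<comment> \<open>A degenerate interval is covered by the empty family, since charged
          intervals must have positive length.\<close>
        proof (cases "a = b")
          case True
          then have "covered a b {}" by (simp add: covered_def)
          then show ?thesis ..
        next
          case False
          have "{a..b} \<subseteq> ball x d" using that by (auto simp: dist_real_def)
          then have "covered a b {(a, b)}"
            using d that False \<open>e > 0\<close> unfolding covered_def by auto
          then show ?thesis ..
        qed
        then show ?thesis using d by blast
      next
        case False
        then have "(y has_vector_derivative 0) (at x within {0..T})"
          using N(1) local \<open>s \<le> T\<close> by auto
        then obtain d where d: "d > 0"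
          "\<And>u. u \<in> {0..T} \<Longrightarrow> norm (u - x) < d \<Longrightarrow> norm (y u - y x) \<le> e * norm (u - x)"
          using \<open>e > 0\<close> unfolding has_vector_derivative_def has_derivative_within_alt by auto
        have "\<exists>D. covered a b D" if "a \<le> x" "x \<le> b" "b - a < d" "0 \<le> a" "b \<le> T" for a b
        proof -
          have "norm (y b - y a) \<le> norm (y b - y x) + norm (y a - y x)" by norm
          also have "\<dots> \<le> e * norm (b - x) + e * norm (a - x)"
            using that by (intro add_mono d(2)) auto
          also have "\<dots> = e * (b - a)" using that by (simp add: algebra_simps)
          finally have "covered a b {}" by (simp add: covered_def)
          then show ?thesis ..
        qed
        then show ?thesis using d by blast
      qed
    qed
    then obtain D where D: "covered 0 s D" using \<open>s \<le> T\<close> by auto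
    then have "finite D" by (simp add: covered_def)
    have sub: "{fst d..snd d} \<subseteq> G" "fst d < snd d" "0 \<le> fst d" "snd d \<le> s" if "d \<in> D" for d
      using D that unfolding covered_def by blast+
    have disj: "{fst d<..<snd d} \<inter> {fst d'<..<snd d'} = {}" if "d \<in> D" "d' \<in> D" "d \<noteq> d'" for d d'
      using D that unfolding covered_def by blast
    \<comment> \<open>The open intervals are disjoint subsets of \<open>G\<close>, so their total
      length is below \<open>\<delta>\<close> and absolute continuity applies to them, once
      \<open>D\<close> is enumerated by \<open>h\<close>.\<close>
    have "(\<Sum>d\<in>D. snd d - fst d) = (\<Sum>d\<in>D. measure lebesgue {fst d<..<snd d})"
      using sub(2) by (intro sum.cong) (auto simp: less_imp_le)
    also have "\<dots> = measure lebesgue (\<Union>d\<in>D. {fst d<..<snd d})"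
      using sub(2) disj \<open>finite D\<close>
      by (intro measure_finite_Union[symmetric])
        (auto simp: disjoint_family_on_def less_imp_le emeasure_lborel_Ioo)
    also have "\<dots> \<le> measure lebesgue G"
      using sub(1) Gm by (intro measure_mono_fmeasurable sets.finite_UN \<open>finite D\<close>) force+
    finally have len: "(\<Sum>d\<in>D. snd d - fst d) < \<delta>" using mG by simp
    obtain h where h: "bij_betw h {..<card D} D"
      using ex_bij_betw_nat_finite[OF \<open>finite D\<close>] by (auto simp: atLeast0LessThan)
    have hD: "h i \<in> D" if "i < card D" for i
      using h that by (auto simp: bij_betw_def)
    have "(\<Sum>i<card D. norm (y (snd (h i)) - y (fst (h i)))) < e"
    proof (rule \<delta>(2), intro conjI allI impI)
      fix i j assume ij: "i < card D" "j < card D" "i \<noteq> j"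
      then have "h i \<noteq> h j" using h unfolding bij_betw_def inj_on_def by auto
      then show "{fst (h i)<..<snd (h i)} \<inter> {fst (h j)<..<snd (h j)} = {}"
        using disj[OF hD hD] ij by blast
    next
      show "(\<Sum>i<card D. snd (h i) - fst (h i)) < \<delta>"
        using len sum.reindex_bij_betw[OF h, of "\<lambda>d. snd d - fst d"] by simp
    next
      fix i assume "i < card D"
      then show "fst (h i) < snd (h i)" "{fst (h i)..snd (h i)} \<subseteq> {0..T}"
        using sub(2-4)[OF hD] \<open>s \<le> T\<close> by force+
    qed
    then have "(\<Sum>d\<in>D. norm (y (snd d) - y (fst d))) < e"
      using sum.reindex_bij_betw[OF h, of "\<lambda>d. norm (y (snd d) - y (fst d))"] by simp
    then show ?thesis using D by (auto simp: covered_def)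
  qed
  have "norm (y s - y 0) \<le> 0"
  proof (rule field_le_epsilon)
    fix e :: real assume "e > 0"
    have "0 \<le> s" using s by simp
    have "norm (y s - y 0) \<le> e / (s + 1) * s + e / (s + 1)"
      using \<open>e > 0\<close> \<open>0 \<le> s\<close> by (intro small) simp
    also have "\<dots> = e / (s + 1) * (s + 1)"
      by (simp only: distrib_left mult_1_right)
    also have "\<dots> = e"
      using \<open>0 \<le> s\<close> by simp
    finally show "norm (y s - y 0) \<le> 0 + e" by simp
  qed
  then show ?thesis by simp
qed

text \<open>The difference between \<open>x\<close> and the integral of the continuous
  \<open>v\<close> is absolutely continuous with zero derivative almost everywhere, hence constant.
  This turns Caratheodory solutions into classical ones.\<close>

lemma absolutely_continuous_has_vector_derivative:
  fixes x :: "real \<Rightarrow> 'a::euclidean_space"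
  assumes ac: "absolutely_continuous_on {0..T} x"
    and ae: "AE t in lebesgue_on {0..T}. (x has_vector_derivative v t) (at t within {0..T})"
    and v: "continuous_on {0..T} v" and t: "t \<in> {0..T}"
  shows "(x has_vector_derivative v t) (at t within {0..T})"
proof -
  define V where "V = (\<lambda>t. integral {0..t} v)"
  have V: "(V has_vector_derivative v t) (at t within {0..T})" if "t \<in> {0..T}" for t
    unfolding V_def using v that by (rule integral_has_vector_derivative)
  obtain B where B: "\<And>t. t \<in> {0..T} \<Longrightarrow> norm (v t) \<le> B"
    using compact_imp_bounded[OF compact_continuous_image[OF v compact_Icc]]
    unfolding bounded_iff by blast
  have "absolutely_continuous_on {0..T} V"
    by (rule absolutely_continuous_on_lipschitz, rule lipschitz_from_vector_derivative[OF _ V B]) auto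
  then have ac': "absolutely_continuous_on {0..T} (\<lambda>t. x t - V t)"
    using ac absolutely_continuous_on_diff by blast
  have ae': "AE t in lebesgue_on {0..T}. ((\<lambda>t. x t - V t) has_vector_derivative 0) (at t within {0..T})"
    using ae AE_space
  proof eventually_elim
    case (elim t)
    then show ?case using has_vector_derivative_diff[OF elim(1) V] by simp
  qed
  have eq: "x s = (x 0 - V 0) + V s" if "s \<in> {0..T}" for s
    using absolutely_continuous_zero_derivative[OF ac' ae' that] by (simp add: diff_eq_eq)
  have "((\<lambda>s. (x 0 - V 0) + V s) has_vector_derivative v t) (at t within {0..T})"
    using has_vector_derivative_add[OF has_vector_derivative_const V[OF t]] by simp
  then show ?thesis
    by (rule has_vector_derivative_transform[rotated 2]) (rule t, erule eq)
qed

text \<open>Bisection sums the local bounds to \<open>h b - h a \<le> \<epsilon> * (b - a)\<close>,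
  and \<open>\<epsilon>\<close> is arbitrary. The factor \<open>u - x\<close> expresses one-sided
  slope bounds on both sides of \<open>x\<close> at once, without requiring \<open>h\<close> to be
  differentiable.\<close>

lemma nonincreasing_if_locally_nonincreasing:
  fixes h :: "real \<Rightarrow> real"
  assumes "a \<le> b"
    and loc: "\<And>x \<epsilon>. \<lbrakk>x \<in> {a..b}; 0 < \<epsilon>\<rbrakk> \<Longrightarrow>
      \<exists>\<delta>>0. \<forall>u\<in>{a..b}. \<bar>u - x\<bar> < \<delta> \<longrightarrow> (u - x) * (h u - h x) \<le> \<epsilon> * (u - x)\<^sup>2"
  shows "h b \<le> h a"
proof -
  have step: "h b - h a \<le> \<epsilon> * (b - a)" if "0 < \<epsilon>" for \<epsilon>
  proof -
    have "a \<le> a \<and> b \<le> b \<longrightarrow> h b - h a \<le> \<epsilon> * (b - a)"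
      using \<open>a \<le> b\<close>
    proof (induction rule: Bolzano[where P = "\<lambda>s t. a \<le> s \<and> t \<le> b \<longrightarrow> h t - h s \<le> \<epsilon> * (t - s)"])
      case (trans r s t)
      then show ?case by (auto simp: algebra_simps)
    next
      case (local x)
      then obtain d where d: "d > 0"
        "\<And>u. u \<in> {a..b} \<Longrightarrow> \<bar>u - x\<bar> < d \<Longrightarrow> (u - x) * (h u - h x) \<le> \<epsilon> * (u - x)\<^sup>2"
        using loc[of x \<epsilon>] \<open>0 < \<epsilon>\<close> by auto
      have "h t - h s \<le> \<epsilon> * (t - s)" if "s \<le> x" "x \<le> t" "t - s < d" "a \<le> s" "t \<le> b" for s t
      proof -
        have "h t - h x \<le> \<epsilon> * (t - x)"
        proof (cases "t = x")
          case False
          then have "(t - x) * (h t - h x) \<le> (t - x) * (\<epsilon> * (t - x))"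
            using d(2)[of t] that by (simp add: power2_eq_square mult_ac)
          then show ?thesis using False that by simp
        qed simp
        moreover have "h x - h s \<le> \<epsilon> * (x - s)"
        proof (cases "s = x")
          case False
          then have "(x - s) * (h x - h s) \<le> (x - s) * (\<epsilon> * (x - s))"
            using d(2)[of s] that by (simp add: power2_eq_square algebra_simps)
          then show ?thesis using False that by simp
        qed simp
        ultimately show ?thesis by (simp add: algebra_simps)
      qed
      then show ?case using d(1) by blast
    qed
    then show ?thesis by simp
  qed
  show ?thesis
  proof (rule field_le_epsilon)
    fix e :: real assume "e > 0"
    then have "h b - h a \<le> e / (b - a + 1) * (b - a)"
      using \<open>a \<le> b\<close> by (intro step) simp
    also have "\<dots> \<le> e"
      using \<open>a \<le> b\<close> \<open>e > 0\<close> by (simp add: divide_simps algebra_simps)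
    finally show "h b \<le> h a + e" by simp
  qed
qed

section \<open>Peano's existence theorem for bounded continuous fields\<close>

text \<open>Euler's scheme with step size \<open>1 / Suc n\<close>. The Euler polygons are replaced by step
  functions; these are uniformly Lipschitz up to the step size, which is enough to obtain a
  subsequence converging pointwise on the whole half-line and to differentiate the limit
  directly.\<close>

definition euler :: "('a::euclidean_space \<Rightarrow> 'a) \<Rightarrow> 'a \<Rightarrow> nat \<Rightarrow> nat \<Rightarrow> 'a" where
  "euler g x0 n k = ((\<lambda>z. z + (1 / real (Suc n)) *\<^sub>R g z) ^^ k) x0"

definition euler_index :: "nat \<Rightarrow> real \<Rightarrow> nat" where
  "euler_index n t = nat \<lfloor>t * real (Suc n)\<rfloor>"

text \<open>Each floor loses less than one step, so the discrete and the true elapsed time differ by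
  at most one step size.\<close>

lemma euler_index_diff:
  assumes "0 \<le> s" "s \<le> t"
  shows "euler_index n s \<le> euler_index n t"
    and "\<bar>(real (euler_index n t) - real (euler_index n s)) / real (Suc n) - (t - s)\<bar> \<le> 1 / real (Suc n)"
proof -
  let ?N = "real (Suc n)"
  have "s * ?N \<le> t * ?N" using assms by (intro mult_right_mono) auto
  then show "euler_index n s \<le> euler_index n t"
    unfolding euler_index_def by (intro nat_mono floor_mono)
  have *: "real (euler_index n r) \<le> r * ?N \<and> r * ?N < real (euler_index n r) + 1" if "0 \<le> r" for r
  proof -
    have "0 \<le> r * ?N" using that by simp
    then have "real (euler_index n r) = of_int \<lfloor>r * ?N\<rfloor>"
      unfolding euler_index_def by simp
    then show ?thesis by linarith
  qed
  have "\<bar>(real (euler_index n t) - real (euler_index n s)) - (t * ?N - s * ?N)\<bar> \<le> 1"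
    using *[of s] *[of t] assms by linarith
  moreover have "(real (euler_index n t) - real (euler_index n s)) / ?N - (t - s) =
    ((real (euler_index n t) - real (euler_index n s)) - (t * ?N - s * ?N)) / ?N"
    by (simp add: field_simps)
  ultimately show "\<bar>(real (euler_index n t) - real (euler_index n s)) / ?N - (t - s)\<bar> \<le> 1 / ?N"
    by (simp add: divide_right_mono)
qed

text \<open>The reference velocity \<open>v\<close> is free: \<open>v = 0\<close> gives the
  Lipschitz bound of the scheme, and the field value at a limit point gives the derivative of the
  limit.\<close>

lemma euler_increment:
  assumes "j \<le> k" "\<And>i. j \<le> i \<Longrightarrow> i < k \<Longrightarrow> norm (g (euler g x0 n i) - v) \<le> e"
  shows "norm (euler g x0 n k - euler g x0 n j - ((real k - real j) / real (Suc n)) *\<^sub>R v)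
    \<le> e * ((real k - real j) / real (Suc n))"
  using assms
proof (induction k rule: dec_induct)
  case base
  then show ?case by simp
next
  case (step k)
  let ?h = "1 / real (Suc n)"
  have eq: "(real (Suc k) - real j) / real (Suc n) = (real k - real j) / real (Suc n) + ?h"
    by (simp add: field_simps)
  have "euler g x0 n (Suc k) = euler g x0 n k + ?h *\<^sub>R g (euler g x0 n k)"
    by (simp add: euler_def)
  then have "euler g x0 n (Suc k) - euler g x0 n j - ((real (Suc k) - real j) / real (Suc n)) *\<^sub>R v
    = (euler g x0 n k - euler g x0 n j - ((real k - real j) / real (Suc n)) *\<^sub>R v)
      + ?h *\<^sub>R (g (euler g x0 n k) - v)"
    unfolding eq by (simp add: algebra_simps)
  also have "norm \<dots> \<le> e * ((real k - real j) / real (Suc n)) + norm (?h *\<^sub>R (g (euler g x0 n k) - v))"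
    using step by (intro norm_triangle_mono) auto
  also have "norm (?h *\<^sub>R (g (euler g x0 n k) - v)) \<le> ?h * e"
    unfolding norm_scaleR using step by (intro mult_mono) auto
  finally show ?case unfolding eq by (simp add: algebra_simps)
qed

context
  fixes g :: "'a::euclidean_space \<Rightarrow> 'a" and x0 :: 'a and B :: real
  assumes g_bound: "\<And>z. norm (g z) \<le> B"
begin

lemma euler_lipschitz:
  assumes "j \<le> k"
  shows "norm (euler g x0 n k - euler g x0 n j) \<le> B * ((real k - real j) / real (Suc n))"
  using euler_increment[OF assms, of g x0 n 0 B] g_bound by simp

lemma bound_nonneg: "0 \<le> B"
  using g_bound[of x0] norm_ge_zero order_trans by blast

lemma euler_step_lipschitz:
  assumes "0 \<le> s" "0 \<le> t"
  shows "norm (euler g x0 n (euler_index n t) - euler g x0 n (euler_index n s))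
    \<le> B * (\<bar>t - s\<bar> + 1 / real (Suc n))"
  using assms
proof (induction s t rule: linorder_wlog)
  case (le s t)
  have "norm (euler g x0 n (euler_index n t) - euler g x0 n (euler_index n s))
    \<le> B * ((real (euler_index n t) - real (euler_index n s)) / real (Suc n))"
    using le by (intro euler_lipschitz euler_index_diff)
  also have "\<dots> \<le> B * (\<bar>t - s\<bar> + 1 / real (Suc n))"
    using euler_index_diff(2)[of s t n] le bound_nonneg by (intro mult_left_mono) linarith+
  finally show ?case .
next
  case (sym s t)
  then show ?case by (metis abs_minus_commute norm_minus_commute)
qed

text \<open>An Arzela-Ascoli argument for step functions: diagonal extraction on the nonnegative
  rationals, then extension to all nonnegative times, because the functions are equicontinuous up to
  the step size.\<close>

lemma euler_convergent_subsequence: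
  obtains k where "strict_mono k"
    "\<And>t. 0 \<le> t \<Longrightarrow> convergent (\<lambda>n. euler g x0 (k n) (euler_index (k n) t))"
proof -
  let ?\<xi> = "\<lambda>n t. euler g x0 n (euler_index n t)"
  \<comment> \<open>The diagonal extraction asks for one bound valid for all times, whereas the
    scheme may grow linearly; the weight \<open>1 + t\<close> compensates and is removed again in
    \<open>convQ\<close>.\<close>
  have bd: "norm (?\<xi> n t /\<^sub>R (1 + t)) \<le> norm x0 + B" if "t \<in> {t \<in> \<rat>. 0 \<le> t}" for n t
  proof -
    have t: "0 \<le> t" using that by simp
    have "norm (?\<xi> n t - x0) \<le> B * (t + 1 / real (Suc n))"
      using euler_step_lipschitz[of 0 t n] t by (simp add: euler_index_def euler_def)
    also have "\<dots> \<le> B * (t + 1)"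
      using bound_nonneg by (intro mult_left_mono add_left_mono) auto
    finally have "norm (?\<xi> n t) \<le> norm x0 + B * (t + 1)"
      using norm_triangle_ineq2[of "?\<xi> n t" x0] by linarith
    also have "\<dots> \<le> (norm x0 + B) * (1 + t)"
      using t by (simp add: algebra_simps)
    finally show ?thesis using t by (simp add: field_simps)
  qed
  have "countable {t \<in> \<rat>. 0 \<le> (t::real)}"
    by (rule countable_subset[OF _ countable_rat]) auto
  then have "\<exists>k. strict_mono k \<and> (\<forall>t\<in>{t \<in> \<rat>. 0 \<le> t}. \<exists>l. (\<lambda>n. ?\<xi> (k n) t /\<^sub>R (1 + t)) \<longlonglongrightarrow> l)"
  proof (rule function_convergent_subsequence[where f = "\<lambda>n t. ?\<xi> n t /\<^sub>R (1 + t)", OF _ bd])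
    fix k :: "nat \<Rightarrow> nat"
    assume "strict_mono k" "\<And>t. t \<in> {t \<in> \<rat>. 0 \<le> t} \<Longrightarrow> \<exists>l. (\<lambda>n. ?\<xi> (k n) t /\<^sub>R (1 + t)) \<longlonglongrightarrow> l"
    then show ?thesis by (intro exI[of _ k] conjI ballI)
  qed
  then obtain k where k: "strict_mono k"
    and conv: "\<forall>t\<in>{t \<in> \<rat>. 0 \<le> t}. \<exists>l. (\<lambda>n. ?\<xi> (k n) t /\<^sub>R (1 + t)) \<longlonglongrightarrow> l"
    by (elim exE conjE)
  have convQ: "Cauchy (\<lambda>n. ?\<xi> (k n) t)" if t: "t \<in> \<rat>" "0 \<le> t" for t
  proof -
    obtain l where "(\<lambda>n. ?\<xi> (k n) t /\<^sub>R (1 + t)) \<longlonglongrightarrow> l" using bspec[OF conv, of t] t by auto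
    then have "(\<lambda>n. (1 + t) *\<^sub>R (?\<xi> (k n) t /\<^sub>R (1 + t))) \<longlonglongrightarrow> (1 + t) *\<^sub>R l"
      by (intro tendsto_intros)
    then have "(\<lambda>n. ?\<xi> (k n) t) \<longlonglongrightarrow> (1 + t) *\<^sub>R l" using that by simp
    then show ?thesis by (rule LIMSEQ_imp_Cauchy)
  qed
  have "convergent (\<lambda>n. ?\<xi> (k n) t)" if "0 \<le> t" for t
  proof -
    have "Cauchy (\<lambda>n. ?\<xi> (k n) t)"
      unfolding Cauchy_def
    proof (intro allI impI)
      fix e :: real assume "e > 0"
      \<comment> \<open>Both the distance from \<open>t\<close> to the rational \<open>r\<close> and
        the step size stay below \<open>d\<close>; the two together cost at most
        \<open>e / 3\<close>.\<close>
      define d where "d = e / (6 * (B + 1))"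
      have d: "d > 0" "B * d \<le> e / 6"
        using \<open>e > 0\<close> bound_nonneg by (auto simp: d_def field_simps)
      obtain r where r: "r \<in> \<rat>" "t < r" "r < t + d"
        using Rats_dense_in_real[of t "t + d"] d by auto
      then have "0 \<le> r" using that by simp
      obtain M where M: "\<And>m n. m \<ge> M \<Longrightarrow> n \<ge> M \<Longrightarrow> dist (?\<xi> (k m) r) (?\<xi> (k n) r) < e / 3"
        using convQ[OF r(1) \<open>0 \<le> r\<close>] \<open>e > 0\<close> unfolding Cauchy_def by (meson divide_pos_pos zero_less_numeral)
      obtain L :: nat where L: "1 / real (Suc L) < d"
        using reals_Archimedean[OF d(1)] by (auto simp: inverse_eq_divide)
      have near: "dist (?\<xi> (k m) t) (?\<xi> (k m) r) \<le> e / 3" if "m \<ge> L" for m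
      proof -
        have "L \<le> k m" using that seq_suble[OF k, of m] by simp
        then have "1 / real (Suc (k m)) \<le> 1 / real (Suc L)"
          by (intro divide_left_mono) auto
        then have "\<bar>t - r\<bar> + 1 / real (Suc (k m)) \<le> d + d" using L r by linarith
        then have "B * (\<bar>t - r\<bar> + 1 / real (Suc (k m))) \<le> B * (d + d)"
          using bound_nonneg by (rule mult_left_mono)
        then show ?thesis
          using euler_step_lipschitz[OF \<open>0 \<le> r\<close> \<open>0 \<le> t\<close>, of "k m"] d(2)
          by (simp add: dist_norm algebra_simps)
      qed
      show "\<exists>M. \<forall>m\<ge>M. \<forall>n\<ge>M. dist (?\<xi> (k m) t) (?\<xi> (k n) t) < e"
      proof (intro exI allI impI)
        fix m n assume mn: "max M L \<le> m" "max M L \<le> n"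
        have "dist (?\<xi> (k m) t) (?\<xi> (k n) t) \<le> dist (?\<xi> (k m) t) (?\<xi> (k m) r)
            + dist (?\<xi> (k m) r) (?\<xi> (k n) r) + dist (?\<xi> (k n) t) (?\<xi> (k n) r)"
          by metric
        then show "dist (?\<xi> (k m) t) (?\<xi> (k n) t) < e"
          using near[of m] near[of n] M[of m n] mn by simp
      qed
    qed
    then show ?thesis by (rule Cauchy_convergent)
  qed
  with k show thesis by (rule that)
qed

text \<open>Replaces the discrete elapsed time by \<open>b - a\<close>; the mismatch of one step
  size causes the two extra terms.\<close>

lemma euler_step_increment:
  assumes "0 \<le> a" "a \<le> b" "0 \<le> e"
    and g: "\<And>i. euler_index n a \<le> i \<Longrightarrow> i < euler_index n b \<Longrightarrow> norm (g (euler g x0 n i) - v) \<le> e"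
  shows "norm (euler g x0 n (euler_index n b) - euler g x0 n (euler_index n a) - (b - a) *\<^sub>R v)
    \<le> e * (b - a + 1 / real (Suc n)) + norm v / real (Suc n)"
proof -
  let ?\<xi> = "\<lambda>t. euler g x0 n (euler_index n t)"
  define D where "D = (real (euler_index n b) - real (euler_index n a)) / real (Suc n)"
  have D: "\<bar>D - (b - a)\<bar> \<le> 1 / real (Suc n)"
    unfolding D_def using assms(1,2) by (rule euler_index_diff)
  have "?\<xi> b - ?\<xi> a - (b - a) *\<^sub>R v = (?\<xi> b - ?\<xi> a - D *\<^sub>R v) + (D - (b - a)) *\<^sub>R v"
    by (simp add: algebra_simps)
  also have "norm \<dots> \<le> e * D + \<bar>D - (b - a)\<bar> * norm v"
    unfolding D_def
    by (intro norm_triangle_mono euler_increment euler_index_diff assms) simp_all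
  also have "\<dots> \<le> e * (b - a + 1 / real (Suc n)) + 1 / real (Suc n) * norm v"
    using D \<open>0 \<le> e\<close> by (intro add_mono mult_left_mono mult_right_mono) (linarith | simp)+
  finally show ?thesis by simp
qed

text \<open>On a short interval around \<open>t\<close> all Euler iterates stay where the field is
  within \<open>e\<close> of its value at \<open>x t\<close>. The resulting increment estimate
  survives the limit, without an integral equation.\<close>

lemma euler_limit_has_vector_derivative:
  assumes cont: "continuous_on UNIV g" and k: "strict_mono k"
    and lim: "\<And>t. 0 \<le> t \<Longrightarrow> (\<lambda>n. euler g x0 (k n) (euler_index (k n) t)) \<longlonglongrightarrow> x t"
    and t: "0 \<le> t"
  shows "(x has_vector_derivative g (x t)) (at t within {0..})"
  unfolding has_vector_derivative_def has_derivative_within_alt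
proof (intro conjI allI impI)
  let ?\<xi> = "\<lambda>n t. euler g x0 n (euler_index n t)"
  let ?v = "g (x t)"
  show "bounded_linear (\<lambda>h. h *\<^sub>R ?v)" by (rule bounded_linear_scaleR_left)
  fix e :: real assume "e > 0"
  obtain \<delta> where \<delta>: "\<delta> > 0" "\<And>z. dist z (x t) < \<delta> \<Longrightarrow> dist (g z) ?v < e"
    using cont \<open>e > 0\<close> unfolding continuous_on_iff by (metis UNIV_I)
  \<comment> \<open>Of the radius \<open>\<delta>\<close>, one third bounds the drift of the
    iterates over an interval of length below \<open>d\<close> including one step, another third the
    distance of the approximation from \<open>x t\<close>.\<close>
  define d where "d = \<delta> / (3 * (B + 1))"
  have d: "d > 0" "B * d < \<delta> / 3"
    using \<delta>(1) bound_nonneg by (auto simp: d_def field_simps)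
  have h0: "(\<lambda>n. 1 / real (Suc (k n))) \<longlonglongrightarrow> 0"
    using LIMSEQ_subseq_LIMSEQ[OF LIMSEQ_Suc[OF lim_1_over_n] k] by (simp add: o_def)
  have key: "norm (x b - x a - (b - a) *\<^sub>R ?v) \<le> e * (b - a)"
    if ab: "0 \<le> a" "a \<le> t" "t \<le> b" "b - a < d" for a b
  proof -
    have "(\<lambda>n. B * (b - a + 1 / real (Suc (k n)))) \<longlonglongrightarrow> B * (b - a + 0)"
      by (intro tendsto_intros h0)
    moreover have "B * (b - a + 0) < \<delta> / 3"
    proof -
      have "B * (b - a) \<le> B * d" using ab bound_nonneg by (intro mult_left_mono) auto
      then show ?thesis using d by simp
    qed
    ultimately have ev1: "\<forall>\<^sub>F n in sequentially. B * (b - a + 1 / real (Suc (k n))) < \<delta> / 3"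
      by (rule order_tendstoD(2))
    have ev2: "\<forall>\<^sub>F n in sequentially. dist (?\<xi> (k n) t) (x t) < \<delta> / 3"
      using lim[OF t] \<delta>(1) by (intro tendstoD) auto
    have "\<forall>\<^sub>F n in sequentially. norm (?\<xi> (k n) b - ?\<xi> (k n) a - (b - a) *\<^sub>R ?v)
      \<le> e * (b - a + 1 / real (Suc (k n))) + norm ?v * (1 / real (Suc (k n)))"
      using ev1 ev2
    proof eventually_elim
      case (elim n)
      let ?I = "euler_index (k n)" and ?E = "euler g x0 (k n)"
      have I: "?I a \<le> ?I t" "?I t \<le> ?I b" using ab t by (auto intro!: euler_index_diff)
      have "norm (g (?E i) - ?v) \<le> e" if i: "?I a \<le> i" "i < ?I b" for i
      proof -
        have "norm (?E i - ?E (?I t)) \<le> B * (\<bar>real i - real (?I t)\<bar> / real (Suc (k n)))"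
          using euler_lipschitz[of i "?I t" "k n"] euler_lipschitz[of "?I t" i "k n"]
          by (cases "i \<le> ?I t") (auto simp: norm_minus_commute abs_if)
        also have "\<dots> \<le> B * ((real (?I b) - real (?I a)) / real (Suc (k n)))"
          using i I bound_nonneg by (intro mult_left_mono divide_right_mono) auto
        also have "\<dots> \<le> B * (b - a + 1 / real (Suc (k n)))"
          using euler_index_diff(2)[of a b "k n"] ab bound_nonneg by (intro mult_left_mono) linarith+
        finally have "dist (?E i) (?E (?I t)) < \<delta> / 3" using elim(1) unfolding dist_norm by linarith
        then have "dist (?E i) (x t) < \<delta>"
          using elim(2) \<delta>(1) dist_triangle[of "?E i" "x t" "?E (?I t)"] by linarith
        from \<delta>(2)[OF this] show ?thesis by (simp add: dist_norm)
      qed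
      then show ?case
        using euler_step_increment[of a b e "k n" ?v] ab \<open>e > 0\<close> by simp
    qed
    moreover have "(\<lambda>n. norm (?\<xi> (k n) b - ?\<xi> (k n) a - (b - a) *\<^sub>R ?v))
        \<longlonglongrightarrow> norm (x b - x a - (b - a) *\<^sub>R ?v)"
      using ab by (intro tendsto_intros lim) auto
    moreover have "(\<lambda>n. e * (b - a + 1 / real (Suc (k n))) + norm ?v * (1 / real (Suc (k n))))
        \<longlonglongrightarrow> e * (b - a + 0) + norm ?v * 0"
      by (intro tendsto_intros h0)
    ultimately have "norm (x b - x a - (b - a) *\<^sub>R ?v) \<le> e * (b - a + 0) + norm ?v * 0"
      by (intro tendsto_le[OF sequentially_bot])
    then show ?thesis by simp
  qed
  have "norm (x u - x t - (u - t) *\<^sub>R ?v) \<le> e * norm (u - t)" if "0 \<le> u" "norm (u - t) < d" for u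
  proof (cases "t \<le> u")
    case True
    then show ?thesis using key[of t u] t that by simp
  next
    case False
    have "norm (x u - x t - (u - t) *\<^sub>R ?v) = norm (x t - x u - (t - u) *\<^sub>R ?v)"
      by (subst norm_minus_cancel[symmetric]) (simp add: algebra_simps)
    then show ?thesis using key[of u t] t that False by simp
  qed
  then show "\<exists>d>0. \<forall>u\<in>{0..}. norm (u - t) < d \<longrightarrow>
      norm (x u - x t - (u - t) *\<^sub>R ?v) \<le> e * norm (u - t)"
    using d(1) by auto
qed

lemma peano_half_line:
  assumes "continuous_on UNIV g"
  obtains x where "x 0 = x0" "\<And>t. 0 \<le> t \<Longrightarrow> (x has_vector_derivative g (x t)) (at t within {0..})"
proof -
  obtain k where k: "strict_mono k"
    and conv: "\<And>t. 0 \<le> t \<Longrightarrow> convergent (\<lambda>n. euler g x0 (k n) (euler_index (k n) t))"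
    using euler_convergent_subsequence by blast
  define x where "x t = lim (\<lambda>n. euler g x0 (k n) (euler_index (k n) t))" for t
  have "(\<lambda>n. euler g x0 (k n) (euler_index (k n) t)) \<longlonglongrightarrow> x t" if "0 \<le> t" for t
    using conv[OF that] by (simp add: x_def convergent_LIMSEQ_iff)
  then have "(x has_vector_derivative g (x t)) (at t within {0..})" if "0 \<le> t" for t
    using euler_limit_has_vector_derivative[OF assms k _ that] by blast
  moreover have "x 0 = x0"
    by (simp add: x_def euler_index_def euler_def)
  ultimately show thesis using that by blast
qed

end

section \<open>Trajectories of the anti-windup field\<close>

context prox_regular_set
begin

text \<open>Since \<open>p a \<in> C\<close>, the squared distance grows at most like \<open>t \<mapsto> (norm (x t - p a))\<^sup>2\<close>, which is
  differentiable; this avoids differentiating the projection.\<close>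

lemma infdist_trajectory_le:
  assumes x: "\<And>t. t \<in> {0..T} \<Longrightarrow> (x has_vector_derivative v t) (at t within {0..T})"
    and tube: "\<And>t. t \<in> {0..T} \<Longrightarrow> infdist (x t) C < 1 / (2 * \<alpha>)"
    and inward: "\<And>t. t \<in> {0..T} \<Longrightarrow> R \<le> infdist (x t) C \<Longrightarrow> v t \<bullet> (x t - proj C (x t)) < 0"
    and init: "infdist (x 0) C \<le> R" and t: "t \<in> {0..T}"
  shows "infdist (x t) C \<le> R"
proof -
  let ?d = "\<lambda>t. infdist (x t) C" and ?p = "\<lambda>t. proj C (x t)"
  have cx: "continuous_on {0..T} x"
    using x by (rule continuous_on_vector_derivative)
  then have cd: "continuous_on {0..T} ?d"
    by (intro continuous_intros)
  have cp: "continuous_on {0..T} ?p"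
    using continuous_on_compose2[OF continuous_on_proj cx] tube by (auto simp: image_subset_iff)
  have "0 \<le> t" "t \<le> T" using t by auto
  \<comment> \<open>The maximum with \<open>R\<close> makes the bisection predicate transitive: the
    distance may move freely below \<open>R\<close> but cannot increase above it.\<close>
  have "0 \<le> (0::real) \<and> t \<le> T \<longrightarrow> ?d t \<le> max (?d 0) R"
    using \<open>0 \<le> t\<close>
  proof (induction rule: Bolzano[where P = "\<lambda>a b. 0 \<le> a \<and> b \<le> T \<longrightarrow> ?d b \<le> max (?d a) R"])
    case (trans a b c)
    then show ?case by auto
  next
    case (local s)
    then have s: "s \<in> {0..T}" using \<open>t \<le> T\<close> by auto
    show ?case
    proof (cases "?d s < R")
      case True
      then obtain \<delta> where \<delta>: "\<delta> > 0" "\<And>u. u \<in> {0..T} \<Longrightarrow> dist u s < \<delta> \<Longrightarrow> dist (?d u) (?d s) < R - ?d s"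
        using cd[unfolded continuous_on_iff] s by (meson diff_gt_0_iff_gt)
      have "?d b \<le> R" if "0 \<le> a" "a \<le> s" "s \<le> b" "b \<le> T" "b - a < \<delta>" for a b
        using \<delta>(2)[of b] that unfolding dist_real_def by auto
      then show ?thesis
        using \<delta>(1) by (intro exI[of _ \<delta>]) (auto intro: max.coboundedI2)
    next
      case False
      define \<eta> where "\<eta> = x s - ?p s"
      define m where "m = - (v s \<bullet> \<eta>)"
      have m: "m > 0" using inward[OF s] False by (simp add: m_def \<eta>_def)
      \<comment> \<open>\<open>e1\<close> bounds the deviation of \<open>q\<close> from
        \<open>2 *\<^sub>R \<eta>\<close> and \<open>e2\<close> the linearisation error of
        \<open>x\<close>. They are chosen so that \<open>v s \<bullet> q \<le> - m\<close>, while
        the remainder contributes at most \<open>(b - a) * m\<close>.\<close>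
      define e1 where "e1 = min 1 (m / (norm (v s) + 1))"
      define e2 where "e2 = m / (2 * norm \<eta> + 1)"
      have "e1 > 0" using m by (auto simp: e1_def intro!: divide_pos_pos add_nonneg_pos)
      then have "e1 / 4 > 0" by simp
      have "e1 \<le> 1" by (simp add: e1_def)
      have e1: "norm (v s) * e1 \<le> m"
      proof -
        have "norm (v s) * e1 \<le> (norm (v s) + 1) * (m / (norm (v s) + 1))"
          using m by (intro mult_mono) (auto simp: e1_def)
        also have "\<dots> = m" by (simp add: add_nonneg_eq_0_iff)
        finally show ?thesis .
      qed
      have "e2 > 0" using m by (auto simp: e2_def intro!: divide_pos_pos add_nonneg_pos)
      have "2 * norm \<eta> + 1 > 0" by (simp add: add_nonneg_pos)
      then have e2: "e2 * (2 * norm \<eta> + 1) = m" by (simp add: e2_def)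
      obtain d1 where d1: "d1 > 0" "\<And>u. u \<in> {0..T} \<Longrightarrow> dist u s < d1 \<Longrightarrow> dist (x u) (x s) < e1 / 4"
        using cx s \<open>e1 / 4 > 0\<close> unfolding continuous_on_iff by blast
      obtain d2 where d2: "d2 > 0" "\<And>u. u \<in> {0..T} \<Longrightarrow> dist u s < d2 \<Longrightarrow> dist (?p u) (?p s) < e1 / 4"
        using cp s \<open>e1 / 4 > 0\<close> unfolding continuous_on_iff by blast
      obtain d3 where d3: "d3 > 0" "\<And>u. u \<in> {0..T} \<Longrightarrow> norm (u - s) < d3 \<Longrightarrow>
          norm (x u - x s - (u - s) *\<^sub>R v s) \<le> e2 * norm (u - s)"
        using x[OF s] \<open>e2 > 0\<close> unfolding has_vector_derivative_def has_derivative_within_alt by blast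
      have "?d b \<le> ?d a" if ab: "0 \<le> a" "a \<le> s" "s \<le> b" "b \<le> T" "b - a < min d1 (min d2 d3)" for a b
      proof -
        \<comment> \<open>The sum of \<open>x b - ?p a\<close> and \<open>x a - ?p a\<close>: its
          product with their difference \<open>x b - x a\<close> is the change of the squared
          distance to the fixed point \<open>?p a\<close>.\<close>
        define q where "q = x b + x a - 2 *\<^sub>R ?p a"
        define r where "r = x b - x a - (b - a) *\<^sub>R v s"
        have a: "a \<in> {0..T}" and b: "b \<in> {0..T}" using ab by auto
        have "q - 2 *\<^sub>R \<eta> = (x b - x s) + (x a - x s) - 2 *\<^sub>R (?p a - ?p s)"
          by (simp add: q_def \<eta>_def algebra_simps scaleR_2)
        moreover have "norm \<dots> \<le> norm (x b - x s) + norm (x a - x s) + 2 * norm (?p a - ?p s)"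
          by norm
        moreover have "norm (x b - x s) < e1 / 4" "norm (x a - x s) < e1 / 4" "norm (?p a - ?p s) < e1 / 4"
          using d1(2)[OF b] d1(2)[OF a] d2(2)[OF a] ab by (auto simp: dist_norm)
        ultimately have q: "norm (q - 2 *\<^sub>R \<eta>) \<le> e1" by simp
        have "r = (x b - x s - (b - s) *\<^sub>R v s) - (x a - x s - (a - s) *\<^sub>R v s)"
          by (simp add: r_def algebra_simps)
        also have "norm \<dots> \<le> e2 * norm (b - s) + e2 * norm (a - s)"
          using ab by (intro norm_triangle_le_diff add_mono d3(2)[OF a] d3(2)[OF b]) auto
        also have "\<dots> = e2 * (b - a)"
          using ab by (simp add: algebra_simps)
        finally have r: "norm r \<le> e2 * (b - a)" .
        have "norm q \<le> norm (2 *\<^sub>R \<eta>) + norm (q - 2 *\<^sub>R \<eta>)" by norm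
        then have nq: "norm q \<le> 2 * norm \<eta> + 1" using q \<open>e1 \<le> 1\<close> by simp
        have "v s \<bullet> (q - 2 *\<^sub>R \<eta>) \<le> norm (v s) * e1"
          using norm_cauchy_schwarz[of "v s" "q - 2 *\<^sub>R \<eta>"] mult_left_mono[OF q norm_ge_zero[of "v s"]] by linarith
        then have "v s \<bullet> q \<le> - m"
          using e1 by (simp add: inner_diff_right m_def)
        then have "(b - a) * (v s \<bullet> q) \<le> (b - a) * - m"
          using ab by (intro mult_left_mono) auto
        moreover have "r \<bullet> q \<le> (e2 * (b - a)) * (2 * norm \<eta> + 1)"
          using norm_cauchy_schwarz[of r q] mult_mono[OF r nq] ab \<open>e2 > 0\<close> by simp
        moreover have "(e2 * (b - a)) * (2 * norm \<eta> + 1) = (b - a) * m"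
          using e2 by (metis mult.assoc mult.commute)
        ultimately have "(x b - x a) \<bullet> q \<le> 0"
          by (simp add: r_def inner_diff_left)
        moreover have "(x b - x a) \<bullet> q = (norm (x b - ?p a))\<^sup>2 - (norm (x a - ?p a))\<^sup>2"
          by (simp add: q_def power2_norm_eq_inner inner_commute algebra_simps)
        ultimately have "(norm (x b - ?p a))\<^sup>2 \<le> (norm (x a - ?p a))\<^sup>2" by linarith
        then have "norm (x b - ?p a) \<le> norm (x a - ?p a)"
          using norm_ge_zero by (rule power2_le_imp_le)
        moreover have "?d b \<le> norm (x b - ?p a)"
          using infdist_le[OF proj_in(2)[OF tube[OF a]], of "x b"] by (simp add: dist_norm)
        ultimately show ?thesis using proj_in(3)[OF tube[OF a]] by simp
      qed
      then show ?thesis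
        using d1(1) d2(1) d3(1) by (intro exI[of _ "min d1 (min d2 d3)"]) (auto intro: max.coboundedI1)
    qed
  qed
  then show ?thesis using init \<open>t \<le> T\<close> by simp
qed

text \<open>The proximal inequality at \<open>p\<close> gives the upper bound. The one at
  \<open>q\<close> gives the lower bound, after trading \<open>y - q\<close> for
  \<open>x - p\<close> at the price of the mixed term.\<close>

lemma proj_set_increment_orthogonal:
  assumes p: "p \<in> proj_set C x" and q: "q \<in> proj_set C y"
    and "\<alpha> * infdist x C \<le> 1" "\<alpha> * infdist y C \<le> 1"
  shows "\<bar>(x - p) \<bullet> (q - p)\<bar> \<le> (norm (q - p))\<^sup>2 + norm (y - x) * norm (q - p)"
proof (rule abs_leI)
  have C: "p \<in> C" "q \<in> C" using p q by (auto simp: proj_set_def)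
  have "(x - p) \<bullet> (q - p) \<le> \<alpha> * infdist x C * (norm (q - p))\<^sup>2"
    using proj_set_prox[OF p C(2)] .
  also have "\<dots> \<le> 1 * (norm (q - p))\<^sup>2"
    using assms by (intro mult_right_mono) auto
  finally show "(x - p) \<bullet> (q - p) \<le> (norm (q - p))\<^sup>2 + norm (y - x) * norm (q - p)"
    by (simp add: add_increasing2)
  have "(y - q) \<bullet> (p - q) \<le> \<alpha> * infdist y C * (norm (p - q))\<^sup>2"
    using proj_set_prox[OF q C(1)] .
  also have "\<dots> \<le> 1 * (norm (q - p))\<^sup>2"
    using assms by (subst norm_minus_commute) (intro mult_right_mono, auto)
  finally have "(y - q) \<bullet> (p - q) \<le> (norm (q - p))\<^sup>2" by simp
  moreover have "(y - x) \<bullet> (q - p) \<le> norm (y - x) * norm (q - p)"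
    by (rule norm_cauchy_schwarz)
  moreover have "- ((x - p) \<bullet> (q - p)) = (y - q) \<bullet> (p - q) + (y - x) \<bullet> (q - p) - (q - p) \<bullet> (q - p)"
    by (simp add: algebra_simps inner_commute)
  ultimately show "- ((x - p) \<bullet> (q - p)) \<le> (norm (q - p))\<^sup>2 + norm (y - x) * norm (q - p)"
    using inner_ge_zero[of "q - p"] by linarith
qed

text \<open>In the first-order expansion of \<open>f\<close>, the gradient is replaced by the
  velocity and the residual. The velocity part is controlled by strong monotonicity of the
  projection, the residual part by near orthogonality. Multiplying by \<open>u - s\<close> treats
  past and future together.\<close>

lemma objective_local_decrease:
  assumes "0 < K" and "2 * \<alpha> * R < 1"
    and tube: "\<And>t. t \<in> S \<Longrightarrow> infdist (x t) C \<le> R"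
    and s: "s \<in> S"
    and x: "(x has_vector_derivative (- G - (1 / K) *\<^sub>R (x s - proj C (x s)))) (at s within S)"
    and f: "GDERIV f (proj C (x s)) :> G"
    and "0 < \<epsilon>"
  shows "\<exists>\<delta>>0. \<forall>u\<in>S. \<bar>u - s\<bar> < \<delta> \<longrightarrow>
    (u - s) * (f (proj C (x u)) - f (proj C (x s)))
      \<le> - (1 - 2 * \<alpha> * R) * (norm (proj C (x u) - proj C (x s)))\<^sup>2 + \<epsilon> * (u - s)\<^sup>2"
proof -
  let ?p = "\<lambda>t. proj C (x t)"
  define c where "c = 1 - 2 * \<alpha> * R"
  define v where "v = - G - (1 / K) *\<^sub>R (x s - ?p s)"
  \<comment> \<open>\<open>Lx\<close> and \<open>Lp\<close> bound the increments of \<open>x\<close>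
    and of its projection per unit of time near \<open>s\<close>; \<open>A\<close> bounds the
    product of the residual with the projected increment, relative to the squared time.\<close>
  define Lx where "Lx = norm v + 1"
  define Lp where "Lp = Lx / c"
  define A where "A = Lp\<^sup>2 + Lx * Lp"
  have c: "c > 0" using assms by (simp add: c_def)
  have Lx: "Lx > 0" by (simp add: Lx_def add_nonneg_pos)
  have Lp: "Lp > 0" using Lx c by (simp add: Lp_def)
  have A: "A > 0" using Lx Lp by (simp add: A_def add_pos_pos)
  define e1 where "e1 = \<epsilon> / (3 * Lp)"
  define e2 where "e2 = min 1 (\<epsilon> / (3 * Lp))"
  have e1: "e1 > 0" "e1 * Lp \<le> \<epsilon> / 3" using Lp \<open>\<epsilon> > 0\<close> by (auto simp: e1_def)
  have e2: "e2 > 0" "e2 \<le> 1" "e2 * Lp \<le> \<epsilon> / 3"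
    using Lp \<open>\<epsilon> > 0\<close> by (auto simp: e2_def min_def field_simps)
  have dist_lt: "infdist (x t) C < 1 / (2 * \<alpha>)" if "t \<in> S" for t
  proof -
    have "R < 1 / (2 * \<alpha>)" using assms(2) alpha_pos by (simp add: field_simps)
    then show ?thesis using tube[OF that] by simp
  qed
  have dist_le: "\<alpha> * infdist (x t) C \<le> \<alpha> * R" if "t \<in> S" for t
    using tube[OF that] alpha_pos by simp
  obtain d1 where d1: "d1 > 0" "\<And>z. norm (z - ?p s) < d1 \<Longrightarrow>
      \<bar>f z - f (?p s) - G \<bullet> (z - ?p s)\<bar> \<le> e1 * norm (z - ?p s)"
    using f e1(1) unfolding gderiv_def has_derivative_at_alt
    by (auto simp: inner_commute real_norm_def)
  obtain d2 where d2: "d2 > 0" "\<And>u. u \<in> S \<Longrightarrow> norm (u - s) < d2 \<Longrightarrow>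
      norm (x u - x s - (u - s) *\<^sub>R v) \<le> e2 * norm (u - s)"
    using x e2(1) unfolding has_vector_derivative_def has_derivative_within_alt v_def by blast
  \<comment> \<open>The three entries serve the linearisation of \<open>x\<close>, the Taylor
    estimate of \<open>f\<close> at the projected point, and the residual term, which is of third
    order in time. Each of the three errors then costs \<open>\<epsilon> / 3\<close>.\<close>
  define \<delta> where "\<delta> = min d2 (min (d1 / Lp) (\<epsilon> * K / (3 * A)))"
  have "\<delta> > 0" using d1 d2 Lp A \<open>\<epsilon> > 0\<close> \<open>K > 0\<close> by (simp add: \<delta>_def)
  moreover have "(u - s) * (f (?p u) - f (?p s)) \<le> - c * (norm (?p u - ?p s))\<^sup>2 + \<epsilon> * (u - s)\<^sup>2"
    if u: "u \<in> S" "\<bar>u - s\<bar> < \<delta>" for u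
  proof -
    define D where "D = u - s"
    define dp where "dp = ?p u - ?p s"
    define dx where "dx = x u - x s"
    define \<eta> where "\<eta> = x s - ?p s"
    note pu = proj_in(1)[OF dist_lt[OF u(1)]] and ps = proj_in(1)[OF dist_lt[OF s]]
    have r: "norm (dx - D *\<^sub>R v) \<le> e2 * \<bar>D\<bar>"
      using d2(2)[OF u(1)] u(2) by (simp add: \<delta>_def D_def dx_def)
    have "norm dx \<le> norm (D *\<^sub>R v) + norm (dx - D *\<^sub>R v)" by (rule norm_triangle_sub)
    also have "\<dots> \<le> \<bar>D\<bar> * norm v + 1 * \<bar>D\<bar>"
      using r mult_right_mono[OF e2(2), of "\<bar>D\<bar>"] by simp
    finally have ndx: "norm dx \<le> Lx * \<bar>D\<bar>" by (simp add: Lx_def algebra_simps)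
    have gap: "c \<le> 1 - \<alpha> * (infdist (x u) C + infdist (x s) C)"
      using dist_le[OF u(1)] dist_le[OF s] by (simp add: c_def algebra_simps)
    have "norm dp \<le> norm dx / c"
      unfolding dp_def dx_def by (rule proj_set_lipschitz[OF pu ps c gap])
    also have "\<dots> \<le> Lx * \<bar>D\<bar> / c" using ndx c by (intro divide_right_mono) auto
    finally have ndp: "norm dp \<le> Lp * \<bar>D\<bar>" by (simp add: Lp_def)
    have "c * (norm dp)\<^sup>2 \<le> (1 - \<alpha> * (infdist (x u) C + infdist (x s) C)) * (norm dp)\<^sup>2"
      using gap by (rule mult_right_mono) auto
    also have "\<dots> \<le> dx \<bullet> dp"
      using proj_set_hypomonotone[OF pu ps] by (simp add: dp_def dx_def)
    finally have mono: "c * (norm dp)\<^sup>2 \<le> dx \<bullet> dp" .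
    have "Lp * \<bar>D\<bar> < d1" using u(2) Lp by (simp add: \<delta>_def D_def field_simps)
    then have taylor: "\<bar>f (?p u) - f (?p s) - G \<bullet> dp\<bar> \<le> e1 * norm dp"
      using d1(2)[of "?p u"] ndp by (simp add: dp_def)
    have "D * (f (?p u) - f (?p s) - G \<bullet> dp) \<le> \<bar>D\<bar> * (e1 * norm dp)"
      using mult_left_mono[OF taylor abs_ge_zero[of D]] by (simp add: abs_mult[symmetric])
    also have "\<dots> \<le> \<bar>D\<bar> * (e1 * (Lp * \<bar>D\<bar>))"
      using ndp e1 by (intro mult_left_mono) auto
    also have "\<dots> = (e1 * Lp) * D\<^sup>2" by (simp add: power2_eq_square)
    also have "\<dots> \<le> \<epsilon> / 3 * D\<^sup>2" using e1(2) by (rule mult_right_mono) simp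
    finally have t1: "D * (f (?p u) - f (?p s) - G \<bullet> dp) \<le> \<epsilon> / 3 * D\<^sup>2" .
    have "(dx - D *\<^sub>R v) \<bullet> dp \<le> (e2 * \<bar>D\<bar>) * (Lp * \<bar>D\<bar>)"
      using norm_cauchy_schwarz[of "dx - D *\<^sub>R v" dp] mult_mono[OF r ndp] e2(1) by simp
    also have "\<dots> = (e2 * Lp) * D\<^sup>2" by (simp add: power2_eq_square)
    also have "\<dots> \<le> \<epsilon> / 3 * D\<^sup>2" using e2(3) by (rule mult_right_mono) simp
    finally have t2: "(dx - D *\<^sub>R v) \<bullet> dp \<le> \<epsilon> / 3 * D\<^sup>2" .
    have "2 * (\<alpha> * R) < 1" using assms(2) by simp
    then have "\<bar>\<eta> \<bullet> dp\<bar> \<le> (norm dp)\<^sup>2 + norm dx * norm dp"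
      unfolding \<eta>_def dp_def dx_def
      using dist_le[OF u(1)] dist_le[OF s] by (intro proj_set_increment_orthogonal[OF ps pu]) linarith+
    also have "\<dots> \<le> (Lp * \<bar>D\<bar>)\<^sup>2 + (Lx * \<bar>D\<bar>) * (Lp * \<bar>D\<bar>)"
      using ndp ndx Lx Lp by (intro add_mono power_mono mult_mono) auto
    also have "\<dots> = A * D\<^sup>2" by (simp add: A_def power2_eq_square algebra_simps)
    finally have "\<bar>\<eta> \<bullet> dp\<bar> \<le> A * D\<^sup>2" .
    then have "\<bar>D\<bar> * \<bar>\<eta> \<bullet> dp\<bar> \<le> (\<epsilon> * K / (3 * A)) * (A * D\<^sup>2)"
      using u(2) by (intro mult_mono) (auto simp: \<delta>_def D_def)
    also have "\<dots> = K * (\<epsilon> / 3 * D\<^sup>2)" using A by simp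
    finally have "- (D * (\<eta> \<bullet> dp)) \<le> K * (\<epsilon> / 3 * D\<^sup>2)"
      by (simp add: abs_mult[symmetric])
    then have t3: "- (D * (\<eta> \<bullet> dp)) / K \<le> \<epsilon> / 3 * D\<^sup>2"
      using \<open>K > 0\<close> by (simp add: field_simps)
    have G: "G = - v - (1 / K) *\<^sub>R \<eta>" by (simp add: v_def \<eta>_def)
    \<comment> \<open>Exchanging \<open>D *\<^sub>R v\<close> for \<open>dx\<close> isolates
      \<open>- (dx \<bullet> dp)\<close>, the only term that is not an error; \<open>mono\<close>
      makes it at most \<open>- c * (norm dp)\<^sup>2\<close>.\<close>
    have "D * (G \<bullet> dp) = - (D * (v \<bullet> dp)) + - (D * (\<eta> \<bullet> dp)) / K"
      unfolding G by (simp add: inner_diff_left right_diff_distrib)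
    also have "\<dots> = (dx - D *\<^sub>R v) \<bullet> dp - dx \<bullet> dp + - (D * (\<eta> \<bullet> dp)) / K"
      by (simp add: algebra_simps)
    finally have "D * (f (?p u) - f (?p s)) \<le> - c * (norm dp)\<^sup>2 + \<epsilon> * D\<^sup>2"
      using t1 t2 t3 mono by (simp add: algebra_simps)
    then show ?thesis by (simp add: D_def dp_def)
  qed
  ultimately show ?thesis unfolding c_def by blast
qed

text \<open>The quadratic term is linearised as \<open>(norm d)\<^sup>2 \<ge> 2 * h * (w \<bullet> d) - h\<^sup>2 * (norm w)\<^sup>2\<close>, which makes the
  local estimate additive in time; the optimal \<open>w\<close> is the mean velocity of the projection.\<close>

lemma objective_decrease:
  assumes "0 < K" and "2 * \<alpha> * R < 1" and "a \<le> b"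
    and tube: "\<And>t. t \<in> {a..b} \<Longrightarrow> infdist (x t) C \<le> R"
    and x: "\<And>t. t \<in> {a..b} \<Longrightarrow>
      (x has_vector_derivative (- G t - (1 / K) *\<^sub>R (x t - proj C (x t)))) (at t within {a..b})"
    and f: "\<And>t. t \<in> {a..b} \<Longrightarrow> GDERIV f (proj C (x t)) :> G t"
  shows "f (proj C (x b)) + (1 - 2 * \<alpha> * R) * (norm (proj C (x b) - proj C (x a)))\<^sup>2 / (b - a)
    \<le> f (proj C (x a))"
proof (cases "a = b")
  case False
  let ?p = "\<lambda>t. proj C (x t)"
  define c where "c = 1 - 2 * \<alpha> * R"
  define w where "w = (1 / (b - a)) *\<^sub>R (?p b - ?p a)"
  define h where "h = (\<lambda>t. f (?p t) + 2 * c * (w \<bullet> ?p t) - c * (norm w)\<^sup>2 * t)"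
  have c: "c > 0" using assms(2) by (simp add: c_def)
  have "h b \<le> h a"
  proof (rule nonincreasing_if_locally_nonincreasing[OF \<open>a \<le> b\<close>])
    fix s \<epsilon> :: real assume s: "s \<in> {a..b}" and "0 < \<epsilon>"
    from objective_local_decrease[OF assms(1,2) tube s x[OF s] f[OF s] \<open>0 < \<epsilon>\<close>]
    obtain \<delta> where \<delta>: "\<delta> > 0" "\<And>u. u \<in> {a..b} \<Longrightarrow> \<bar>u - s\<bar> < \<delta> \<Longrightarrow>
        (u - s) * (f (?p u) - f (?p s)) \<le> - c * (norm (?p u - ?p s))\<^sup>2 + \<epsilon> * (u - s)\<^sup>2"
      unfolding c_def by blast
    have "(u - s) * (h u - h s) \<le> \<epsilon> * (u - s)\<^sup>2" if "u \<in> {a..b}" "\<bar>u - s\<bar> < \<delta>" for u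
    proof -
      have "0 \<le> c * (norm ((?p u - ?p s) - (u - s) *\<^sub>R w))\<^sup>2" using c by simp
      also have "\<dots> = c * (norm (?p u - ?p s))\<^sup>2 - 2 * c * (u - s) * (w \<bullet> (?p u - ?p s)) + c * (u - s)\<^sup>2 * (norm w)\<^sup>2"
        unfolding power2_norm_eq_inner by (simp add: power2_eq_square inner_commute algebra_simps)
      finally have "2 * c * (u - s) * (w \<bullet> (?p u - ?p s)) - c * (u - s)\<^sup>2 * (norm w)\<^sup>2 \<le> c * (norm (?p u - ?p s))\<^sup>2"
        by simp
      moreover have "(u - s) * (h u - h s) = (u - s) * (f (?p u) - f (?p s))
          + (2 * c * (u - s) * (w \<bullet> (?p u - ?p s)) - c * (u - s)\<^sup>2 * (norm w)\<^sup>2)"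
        by (simp add: h_def power2_eq_square algebra_simps)
      ultimately show ?thesis using \<delta>(2)[OF that] by simp
    qed
    then show "\<exists>\<delta>>0. \<forall>u\<in>{a..b}. \<bar>u - s\<bar> < \<delta> \<longrightarrow> (u - s) * (h u - h s) \<le> \<epsilon> * (u - s)\<^sup>2"
      using \<delta>(1) by blast
  qed
  moreover have "2 * c * (w \<bullet> ?p b) - 2 * c * (w \<bullet> ?p a) - c * (norm w)\<^sup>2 * (b - a)
    = c * (norm (?p b - ?p a))\<^sup>2 / (b - a)"
  proof -
    have pb: "?p b - ?p a = (b - a) *\<^sub>R w" using False by (simp add: w_def)
    have "2 * c * (w \<bullet> ?p b) - 2 * c * (w \<bullet> ?p a) = 2 * c * (w \<bullet> (?p b - ?p a))"
      by (simp add: inner_diff_right right_diff_distrib)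
    also have "\<dots> = 2 * c * (b - a) * (norm w)\<^sup>2"
      unfolding pb by (simp add: power2_norm_eq_inner)
    finally have "2 * c * (w \<bullet> ?p b) - 2 * c * (w \<bullet> ?p a) - c * (norm w)\<^sup>2 * (b - a)
      = c * (b - a) * (norm w)\<^sup>2" by (simp add: algebra_simps)
    also have "\<dots> = c * (norm (?p b - ?p a))\<^sup>2 / (b - a)"
      unfolding pb norm_scaleR power_mult_distrib power2_abs
      using False by (simp add: power2_eq_square)
    finally show ?thesis .
  qed
  ultimately show ?thesis by (simp add: h_def c_def algebra_simps)
qed simp

end

text \<open>With the integrating factor \<open>exp (t / K)\<close>, the derivative of the weighted
  deviation from the fixed target \<open>q\<close> is dominated by that of
  \<open>e * exp (t / K)\<close>.\<close>

lemma relaxation_estimate: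
  fixes x :: "real \<Rightarrow> 'a::real_normed_vector"
  assumes "a < b" "0 < K"
    and x: "\<And>t. t \<in> {a..b} \<Longrightarrow> (x has_vector_derivative v t) (at t within {a..b})"
    and v: "\<And>t. t \<in> {a..b} \<Longrightarrow> norm (K *\<^sub>R v t + (x t - q)) \<le> e"
  shows "norm (x b - q) \<le> exp (- (b - a) / K) * norm (x a - q) + e"
proof -
  define y where "y = (\<lambda>t. exp (t / K) *\<^sub>R (x t - q))"
  have y: "(y has_vector_derivative (exp (t / K) / K) *\<^sub>R (K *\<^sub>R v t + (x t - q))) (at t within {a..b})"
    if "t \<in> {a..b}" for t
    unfolding y_def using \<open>0 < K\<close>
    by (auto intro!: derivative_eq_intros x that simp: scaleR_add_right)
  have "norm (y b - y a) \<le> e * exp (b / K) - e * exp (a / K)"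
  proof (rule differentiable_bound_general[OF \<open>a < b\<close>])
    show "continuous_on {a..b} y" using y by (rule continuous_on_vector_derivative)
    show "continuous_on {a..b} (\<lambda>t. e * exp (t / K))" using \<open>0 < K\<close> by (intro continuous_intros) auto
    fix t assume t: "a < t" "t < b"
    show "(y has_vector_derivative (exp (t / K) / K) *\<^sub>R (K *\<^sub>R v t + (x t - q))) (at t)"
      using y[of t] t by (simp add: at_within_Icc_at)
    have "((\<lambda>t. e * exp (t / K)) has_field_derivative exp (t / K) / K * e) (at t)"
      using \<open>0 < K\<close> by (auto intro!: derivative_eq_intros)
    then show "((\<lambda>t. e * exp (t / K)) has_vector_derivative exp (t / K) / K * e) (at t)"
      by (simp add: has_real_derivative_iff_has_vector_derivative)
    show "norm ((exp (t / K) / K) *\<^sub>R (K *\<^sub>R v t + (x t - q))) \<le> exp (t / K) / K * e"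
      using v[of t] t \<open>0 < K\<close> unfolding norm_scaleR by (intro mult_mono) auto
  qed
  moreover have "norm (y b) \<le> norm (y b - y a) + norm (y a)" by norm
  moreover have "0 \<le> e * exp (a / K)" using order_trans[OF norm_ge_zero v[of a]] \<open>a < b\<close> by simp
  ultimately have "exp (b / K) * norm (x b - q) \<le> exp (a / K) * norm (x a - q) + e * exp (b / K)"
    by (simp add: y_def)
  also have "exp (a / K) = exp (b / K) * exp (- (b - a) / K)"
    by (simp add: exp_add[symmetric] diff_divide_distrib)
  finally have "exp (b / K) * norm (x b - q) \<le> exp (b / K) * (exp (- (b - a) / K) * norm (x a - q) + e)"
    by (simp add: algebra_simps)
  then show ?thesis by simp
qed

lemma absolutely_continuous_imp_continuous_on:
  assumes "absolutely_continuous_on {0..T} x"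
  shows "continuous_on {0..T} x"
  unfolding continuous_on_iff
proof (intro ballI allI impI)
  fix s e :: real assume s: "s \<in> {0..T}" and "e > 0"
  obtain \<delta> where \<delta>: "\<delta> > 0" "\<And>(n :: nat) a b.
        (\<forall>i<n. a i < b i \<and> {a i..b i} \<subseteq> {0..T}) \<and>
        (\<forall>i<n. \<forall>j<n. i \<noteq> j \<longrightarrow> {a i<..<b i} \<inter> {a j<..<b j} = {}) \<and>
        (\<Sum>i<n. b i - a i) < \<delta> \<Longrightarrow>
        (\<Sum>i<n. norm (x (b i) - x (a i))) < e"
    using assms \<open>e > 0\<close> unfolding absolutely_continuous_on_def by blast
  have "dist (x u) (x s) < e" if u: "u \<in> {0..T}" "dist u s < \<delta>" for u
  proof (cases u s rule: linorder_cases)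
    case less
    then show ?thesis
      using \<delta>(2)[of 1 "\<lambda>_. u" "\<lambda>_. s"] u s by (auto simp: dist_norm norm_minus_commute)
  next
    case greater
    then show ?thesis
      using \<delta>(2)[of 1 "\<lambda>_. s" "\<lambda>_. u"] u s by (auto simp: dist_norm)
  qed (use \<open>e > 0\<close> in simp)
  then show "\<exists>d>0. \<forall>u\<in>{0..T}. dist u s < d \<longrightarrow> dist (x u) (x s) < e"
    using \<delta>(1) by blast
qed

text \<open>Uniqueness of the derivative is what gives the definite description in
  \<open>gradient\<close> its value.\<close>

lemma GDERIV_gradient:
  assumes "GDERIV f x :> D"
  shows "GDERIV f x :> gradient f x"
proof -
  have "E = D" if "GDERIV f x :> E" for E
  proof -
    have "(\<lambda>h. h \<bullet> E) = (\<lambda>h. h \<bullet> D)"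
      using that assms unfolding gderiv_def by (rule has_derivative_unique)
    then have "(E - D) \<bullet> E = (E - D) \<bullet> D" by (rule fun_cong)
    then have "(E - D) \<bullet> (E - D) = 0" unfolding inner_diff_right[of "E - D"] by simp
    then show ?thesis by simp
  qed
  with assms show ?thesis
    unfolding gradient_def by (rule theI)
qed

text \<open>Used to pick a radius that covers the initial distance, exceeds \<open>K * M\<close> and
  stays below \<open>1 / (2 * \<alpha>)\<close>.\<close>

lemma max_midpoint_bounds:
  fixes d k u :: real
  assumes "d < u" "k < u"
  shows "max d ((k + u) / 2) < u" "k < max d ((k + u) / 2)"
  using assms by (auto simp: max_def)

section \<open>Regularity of the field on the tube, confinement and existence of solutions\<close>

locale antiwindup = prox_regular_set C \<alpha> for C :: "'a::euclidean_space set" and \<alpha> +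
  fixes f :: "'a \<Rightarrow> real"
  assumes cdiff: "continuously_differentiable_near C f"
    and compact_sublevel: "\<And>l. compact (sublevel_set C f l)"
begin

lemma GDERIV_f:
  assumes "p \<in> C"
  shows "GDERIV f p :> gradient f p"
  using cdiff assms GDERIV_gradient unfolding continuously_differentiable_near_def by blast

lemma continuous_on_gradient: "continuous_on C (gradient f)"
  using cdiff continuous_on_subset unfolding continuously_differentiable_near_def by blast

lemma continuous_on_f: "continuous_on C f"
proof -
  have "continuous (at p within C) f" if "p \<in> C" for p
    using GDERIV_f[OF that] has_derivative_continuous continuous_at_imp_continuous_at_within
    unfolding gderiv_def by blast
  then show ?thesis by (simp add: continuous_on_eq_continuous_within)
qed

lemma gradient_bound:
  obtains M where "0 < M" "\<And>p. p \<in> C \<Longrightarrow> f p \<le> l \<Longrightarrow> norm (gradient f p) \<le> M"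
proof -
  have "continuous_on (sublevel_set C f l) (gradient f)"
    using continuous_on_gradient by (rule continuous_on_subset) (auto simp: sublevel_set_def)
  then have "bounded (gradient f ` sublevel_set C f l)"
    using compact_sublevel by (intro compact_imp_bounded compact_continuous_image)
  then obtain M where "0 < M" "\<forall>v \<in> gradient f ` sublevel_set C f l. norm v \<le> M"
    unfolding bounded_pos by blast
  then show thesis using that[of M] by (auto simp: sublevel_set_def)
qed

lemma tube_sublevel_iff:
  "x \<in> tube_sublevel \<alpha> C f l \<longleftrightarrow> infdist x C < 1 / (2 * \<alpha>) \<and> f (proj C x) \<le> l"
proof
  assume x: "x \<in> tube_sublevel \<alpha> C f l"
  then have "infdist x C < 1 / (2 * \<alpha>)"
    using open_tube_infdist(1)[of x C "1 / (2 * \<alpha>)"] alpha_pos by (simp add: tube_sublevel_def)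
  then show "infdist x C < 1 / (2 * \<alpha>) \<and> f (proj C x) \<le> l"
    using x proj_set_eq[of x] by (auto simp: tube_sublevel_def sublevel_set_def)
next
  assume x: "infdist x C < 1 / (2 * \<alpha>) \<and> f (proj C x) \<le> l"
  then have "x \<in> open_tube C (1 / (2 * \<alpha>))"
    using proj_in(2,3)[of x] in_open_tubeI[of "proj C x" C x] by simp
  moreover have "proj C x \<in> sublevel_set C f l"
    using x proj_in(2)[of x] by (simp add: sublevel_set_def)
  ultimately show "x \<in> tube_sublevel \<alpha> C f l"
    using x proj_set_eq[of x] unfolding tube_sublevel_def by blast
qed

definition field :: "real \<Rightarrow> 'a \<Rightarrow> 'a" where
  "field K x = - gradient f (proj C x) - (1 / K) *\<^sub>R (x - proj C x)"

lemma antiwindup_field_eq: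
  assumes "infdist x C < 1 / (2 * \<alpha>)"
  shows "antiwindup_field C f K x = {field K x}"
  unfolding antiwindup_field_def proj_set_eq[OF assms] field_def by auto

lemma continuous_on_f_proj: "continuous_on {x. infdist x C < 1 / (2 * \<alpha>)} (\<lambda>x. f (proj C x))"
  using proj_in(2) by (intro continuous_on_compose2[OF continuous_on_f continuous_on_proj]) auto

lemma continuous_on_field: "continuous_on {x. infdist x C < 1 / (2 * \<alpha>)} (field K)"
proof -
  have "continuous_on {x. infdist x C < 1 / (2 * \<alpha>)} (\<lambda>x. gradient f (proj C x))"
    using proj_in(2) by (intro continuous_on_compose2[OF continuous_on_gradient continuous_on_proj]) auto
  then show ?thesis
    unfolding field_def by (intro continuous_intros continuous_on_proj)
qed

text \<open>The inner product of the field with the residual is at most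
  \<open>norm ?\<eta> * (K * M - norm ?\<eta>) / K\<close>: at distance \<open>R\<close> or more the
  restoring term outweighs the gradient, so the field points inward.\<close>

lemma infdist_solution_le:
  assumes "0 < K" "K * M < R"
    and x: "\<And>t. t \<in> {0..T} \<Longrightarrow> (x has_vector_derivative field K (x t)) (at t within {0..T})"
    and tube: "\<And>t. t \<in> {0..T} \<Longrightarrow> infdist (x t) C < 1 / (2 * \<alpha>)"
    and M: "\<And>t. t \<in> {0..T} \<Longrightarrow> norm (gradient f (proj C (x t))) \<le> M"
    and init: "infdist (x 0) C \<le> R" and t: "t \<in> {0..T}"
  shows "infdist (x t) C \<le> R"
proof (rule infdist_trajectory_le[OF x tube _ init t])
  fix s assume s: "s \<in> {0..T}" and R: "R \<le> infdist (x s) C"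
  let ?\<eta> = "x s - proj C (x s)"
  have \<eta>: "norm ?\<eta> = infdist (x s) C" by (rule proj_in(3)[OF tube[OF s]])
  have "0 \<le> M" using M[OF s] norm_ge_zero order_trans by blast
  then have "0 \<le> K * M" using \<open>0 < K\<close> by simp
  then have pos: "norm ?\<eta> > 0" using \<eta> R \<open>K * M < R\<close> by linarith
  have "- (gradient f (proj C (x s)) \<bullet> ?\<eta>) \<le> M * norm ?\<eta>"
    using Cauchy_Schwarz_ineq2[of "gradient f (proj C (x s))" ?\<eta>]
      mult_right_mono[OF M[OF s] norm_ge_zero[of ?\<eta>]] by linarith
  then have "field K (x s) \<bullet> ?\<eta> \<le> M * norm ?\<eta> - (1 / K) * (norm ?\<eta>)\<^sup>2"
    unfolding field_def power2_norm_eq_inner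
    by (simp only: inner_diff_left[of "- gradient f (proj C (x s))"] inner_scaleR_left inner_minus_left)
  also have "\<dots> = norm ?\<eta> * (K * M - norm ?\<eta>) / K"
    using \<open>0 < K\<close> by (simp add: power2_eq_square field_simps)
  also have "\<dots> < 0"
    using pos \<open>0 < K\<close> \<open>K * M < R\<close> R \<eta> by (intro divide_neg_pos mult_pos_neg) auto
  finally show "field K (x s) \<bullet> ?\<eta> < 0" .
qed

lemma objective_solution_le:
  assumes "0 < K" "2 * \<alpha> * R < 1" "0 \<le> a" "a \<le> b"
    and x: "\<And>t. t \<in> {0..b} \<Longrightarrow> (x has_vector_derivative field K (x t)) (at t within {0..b})"
    and R: "\<And>t. t \<in> {0..b} \<Longrightarrow> infdist (x t) C \<le> R"
  shows "f (proj C (x b)) + (1 - 2 * \<alpha> * R) * (norm (proj C (x b) - proj C (x a)))\<^sup>2 / (b - a)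
    \<le> f (proj C (x a))"
proof (rule objective_decrease[OF assms(1,2) \<open>a \<le> b\<close>])
  have "R < 1 / (2 * \<alpha>)" using assms(2) alpha_pos by (simp add: field_simps)
  fix t assume t: "t \<in> {a..b}"
  then have t0: "t \<in> {0..b}" using \<open>0 \<le> a\<close> by auto
  show "infdist (x t) C \<le> R" by (rule R[OF t0])
  show "(x has_vector_derivative - gradient f (proj C (x t)) - (1 / K) *\<^sub>R (x t - proj C (x t))) (at t within {a..b})"
    using x[OF t0] unfolding field_def
    by (rule has_vector_derivative_within_subset) (use \<open>0 \<le> a\<close> in auto)
  show "GDERIV f (proj C (x t)) :> gradient f (proj C (x t))"
    using R[OF t0] \<open>R < 1 / (2 * \<alpha>)\<close> by (intro GDERIV_f proj_in(2)) simp
qed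

text \<open>For radii below \<open>1 / (2 * \<alpha>)\<close> this is a closed set on which the
  field is continuous up to the boundary, as the Tietze extension requires.\<close>

definition thin_tube :: "real \<Rightarrow> real \<Rightarrow> 'a set" where
  "thin_tube r l = {x. infdist x C \<le> r \<and> f (proj C x) \<le> l}"

lemma closed_thin_tube:
  assumes "r < 1 / (2 * \<alpha>)"
  shows "closed (thin_tube r l)"
proof -
  have "closed {x. infdist x C \<le> r}" by (intro closed_Collect_le continuous_intros)
  then have "closed ({x. infdist x C \<le> r} \<inter> (\<lambda>x. f (proj C x)) -` {..l})"
    using assms
    by (intro continuous_closed_preimage continuous_on_subset[OF continuous_on_f_proj]) auto
  moreover have "{x. infdist x C \<le> r} \<inter> (\<lambda>x. f (proj C x)) -` {..l} = thin_tube r l"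
    by (auto simp: thin_tube_def)
  ultimately show ?thesis by simp
qed

lemma thin_tube_interior:
  assumes "R < r" "l < l'" "r < 1 / (2 * \<alpha>)" "z \<in> thin_tube R l"
  obtains e where "0 < e" "ball z e \<subseteq> thin_tube r l'"
proof -
  have "open {x. infdist x C < r}" by (intro open_Collect_less continuous_intros)
  then have "open ({x. infdist x C < r} \<inter> (\<lambda>x. f (proj C x)) -` {..<l'})"
    using assms
    by (intro continuous_open_preimage continuous_on_subset[OF continuous_on_f_proj]) auto
  moreover have "z \<in> {x. infdist x C < r} \<inter> (\<lambda>x. f (proj C x)) -` {..<l'}"
    using assms by (auto simp: thin_tube_def)
  ultimately obtain e where "0 < e" "ball z e \<subseteq> {x. infdist x C < r} \<inter> (\<lambda>x. f (proj C x)) -` {..<l'}"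
    using open_contains_ball by metis
  then show thesis using that[of e] by (force simp: thin_tube_def)
qed

text \<open>Bolzano's principle again: the solution stays in the larger tube because, as long as it does,
  it already lies in the smaller one, which is contained in the interior of the larger one.\<close>

lemma stays_in_thin_tube:
  fixes x :: "real \<Rightarrow> 'a"
  assumes "R < r" "l < l'" "r < 1 / (2 * \<alpha>)" and cx: "continuous_on {0..T} x" and "0 \<le> T"
    and init: "x 0 \<in> thin_tube R l"
    and step: "\<And>t. t \<in> {0..T} \<Longrightarrow> (\<And>s. s \<in> {0..t} \<Longrightarrow> x s \<in> thin_tube r l') \<Longrightarrow> x t \<in> thin_tube R l"
  shows "x T \<in> thin_tube R l"
proof -
  have init': "x 0 \<in> thin_tube r l'" using init assms by (auto simp: thin_tube_def)
  have "0 \<le> (0::real) \<and> T \<le> T \<longrightarrow> (\<forall>s\<in>{0..0}. x s \<in> thin_tube r l') \<longrightarrow> (\<forall>s\<in>{0..T}. x s \<in> thin_tube r l')"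
    using \<open>0 \<le> T\<close>
  proof (induction rule: Bolzano[where P = "\<lambda>a b. 0 \<le> a \<and> b \<le> T \<longrightarrow>
      (\<forall>s\<in>{0..a}. x s \<in> thin_tube r l') \<longrightarrow> (\<forall>s\<in>{0..b}. x s \<in> thin_tube r l')"])
    case (trans a b c)
    then show ?case by (meson order_trans)
  next
    case (local t)
    then have t: "t \<in> {0..T}" by simp
    show ?case
    proof (cases "\<forall>s\<in>{0..t}. x s \<in> thin_tube r l'")
      case True
      then have "x t \<in> thin_tube R l" using step[OF t] by blast
      then obtain e where e: "0 < e" "ball (x t) e \<subseteq> thin_tube r l'"
        using thin_tube_interior assms(1-3) by blast
      obtain d where d: "0 < d" "\<And>s. s \<in> {0..T} \<Longrightarrow> dist s t < d \<Longrightarrow> dist (x s) (x t) < e"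
        using cx t e(1) unfolding continuous_on_iff by blast
      \<comment> \<open>Times up to \<open>a\<close> are covered by the hypothesis of the
        implication, later ones by continuity at \<open>t\<close>.\<close>
      have "x s \<in> thin_tube r l'"
        if "0 \<le> a" "a \<le> t" "t \<le> b" "b \<le> T" "b - a < d" "\<forall>s\<in>{0..a}. x s \<in> thin_tube r l'" "s \<in> {0..b}" for a b s
      proof (cases "s \<le> a")
        case False
        then have "dist (x s) (x t) < e" using that by (intro d(2)) (auto simp: dist_real_def)
        then show ?thesis using e(2) by (auto simp: dist_commute)
      qed (use that in auto)
      then show ?thesis using d(1) by (intro exI[of _ d]) blast
    next
      \<comment> \<open>The bisection predicate is now vacuous near \<open>t\<close>: either an exit
        before \<open>t\<close> precedes every nearby \<open>a\<close>, or the exit is at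
        \<open>t\<close> itself and, the complement being open, \<open>x a\<close> is outside as
        well.\<close>
      case False
      then obtain s where s: "0 \<le> s" "s \<le> t" "x s \<notin> thin_tube r l'" by auto
      show ?thesis
      proof (cases "s = t")
        case True
        have "open (- thin_tube r l')" using closed_thin_tube[OF assms(3)] by blast
        then obtain e where e: "0 < e" "ball (x t) e \<subseteq> - thin_tube r l'"
          using s(3) True open_contains_ball by (metis ComplI)
        obtain d where d: "0 < d" "\<And>s. s \<in> {0..T} \<Longrightarrow> dist s t < d \<Longrightarrow> dist (x s) (x t) < e"
          using cx t e(1) unfolding continuous_on_iff by blast
        have "x a \<notin> thin_tube r l'" if "0 \<le> a" "a \<le> t" "t \<le> b" "b \<le> T" "b - a < d" for a b
        proof -
          have "dist (x a) (x t) < e" using that by (intro d(2)) (auto simp: dist_real_def)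
          then show ?thesis using e(2) by (auto simp: dist_commute)
        qed
        then show ?thesis using d(1) by (intro exI[of _ d]) force
      next
        case False
        then have "0 < t - s" using s by simp
        moreover have "\<not> (\<forall>s\<in>{0..a}. x s \<in> thin_tube r l')" if "a \<le> t" "t \<le> b" "b - a < t - s" for a b
          using s that by (intro notI) (drule bspec[of _ _ s], auto)
        ultimately show ?thesis by blast
      qed
    qed
  qed
  then have "\<And>s. s \<in> {0..T} \<Longrightarrow> x s \<in> thin_tube r l'" using init' by simp
  then show ?thesis using step[of T] \<open>0 \<le> T\<close> by simp
qed

lemma complete_solution_exists:
  assumes "0 < K" "K * M < 1 / (2 * \<alpha>)"
    and M: "\<And>p. p \<in> C \<Longrightarrow> f p \<le> l + 1 \<Longrightarrow> norm (gradient f p) \<le> M"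
    and x0: "x0 \<in> tube_sublevel \<alpha> C f l"
  obtains x where "complete_solution (antiwindup_field C f K) x" "x 0 = x0"
    "\<And>t. 0 \<le> t \<Longrightarrow> x t \<in> tube_sublevel \<alpha> C f l"
proof -
  define R where "R = max (infdist x0 C) ((K * M + 1 / (2 * \<alpha>)) / 2)"
  \<comment> \<open>The larger radius \<open>r\<close> and the level \<open>l + 1\<close> leave room
    around the set that confines the solution, so that the modified field agrees with the original
    one nearby.\<close>
  define r where "r = (R + 1 / (2 * \<alpha>)) / 2"
  have x0': "infdist x0 C < 1 / (2 * \<alpha>)" "f (proj C x0) \<le> l"
    using x0 by (auto simp: tube_sublevel_iff)
  have R: "R < 1 / (2 * \<alpha>)" "K * M < R" "infdist x0 C \<le> R"
    using max_midpoint_bounds[OF x0'(1) assms(2)] by (simp_all add: R_def)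
  have r: "R < r" "r < 1 / (2 * \<alpha>)" using R(1) by (auto simp: r_def)
  have R2: "2 * \<alpha> * R < 1" using R(1) alpha_pos by (simp add: field_simps)
  have tube: "infdist z C < 1 / (2 * \<alpha>)" if "z \<in> thin_tube r (l + 1)" for z
    using that r by (auto simp: thin_tube_def)
  have grad: "norm (gradient f (proj C z)) \<le> M" if "z \<in> thin_tube r (l + 1)" for z
    using that M proj_in(2)[OF tube[OF that]] by (auto simp: thin_tube_def)
  have bound: "norm (field K z) \<le> M + r / K" if "z \<in> thin_tube r (l + 1)" for z
  proof -
    have "norm (field K z) \<le> norm (gradient f (proj C z)) + norm ((1 / K) *\<^sub>R (z - proj C z))"
      unfolding field_def by (metis norm_minus_cancel norm_triangle_ineq4)
    also have "\<dots> \<le> M + r / K"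
      using grad[OF that] that proj_in(3)[OF tube[OF that]] \<open>0 < K\<close>
      by (intro add_mono) (auto simp: thin_tube_def divide_right_mono)
    finally show ?thesis .
  qed
  have "x0 \<in> thin_tube R l" using x0' R by (simp add: thin_tube_def)
  then have "x0 \<in> thin_tube r (l + 1)" using r by (auto simp: thin_tube_def)
  then have "0 \<le> M + r / K" using bound norm_ge_zero order_trans by blast
  moreover have "continuous_on (thin_tube r (l + 1)) (field K)"
    using tube by (intro continuous_on_subset[OF continuous_on_field]) auto
  moreover have "closedin (top_of_set UNIV) (thin_tube r (l + 1))"
    using closed_thin_tube[OF r(2)] by simp
  \<comment> \<open>The Tietze extension keeps the norm bound, so Peano's theorem applies on the
    whole half-line with no blow-up.\<close>
  ultimately obtain g where g: "continuous_on UNIV g"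
    and g_eq: "\<And>z. z \<in> thin_tube r (l + 1) \<Longrightarrow> g z = field K z"
    and g_bound: "\<And>z. z \<in> UNIV \<Longrightarrow> norm (g z) \<le> M + r / K"
    using Tietze[of "thin_tube r (l + 1)" "field K" UNIV "M + r / K"] bound by metis
  obtain x where x_0: "x 0 = x0"
    and x: "\<And>t. 0 \<le> t \<Longrightarrow> (x has_vector_derivative g (x t)) (at t within {0..})"
    using peano_half_line[of g "M + r / K" x0] g g_bound by blast
  have xT: "(x has_vector_derivative g (x t)) (at t within {0..T})" if "t \<in> {0..T}" for t T
    by (rule has_vector_derivative_within_subset[OF x]) (use that in auto)
  have in_tube: "x T \<in> thin_tube R l" if "0 \<le> T" for T
  proof (rule stays_in_thin_tube[OF r(1) _ r(2) _ that])
    show "l < l + 1" by simp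
    show "continuous_on {0..T} x" using xT by (rule continuous_on_vector_derivative)
    show "x 0 \<in> thin_tube R l" using \<open>x0 \<in> thin_tube R l\<close> x_0 by simp
    fix t assume t: "t \<in> {0..T}" and sub: "\<And>s. s \<in> {0..t} \<Longrightarrow> x s \<in> thin_tube r (l + 1)"
    have deriv: "(x has_vector_derivative field K (x s)) (at s within {0..t})" if "s \<in> {0..t}" for s
      using xT[OF that] g_eq[OF sub[OF that]] by simp
    have dist: "infdist (x s) C \<le> R" if "s \<in> {0..t}" for s
      using infdist_solution_le[OF \<open>0 < K\<close> R(2) deriv tube[OF sub] grad[OF sub] _ that] R(3) x_0 by simp
    have "f (proj C (x t)) \<le> f (proj C (x 0))"
    proof -
      have "0 \<le> (1 - 2 * \<alpha> * R) * (norm (proj C (x t) - proj C (x 0)))\<^sup>2 / (t - 0)"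
        using R2 t by simp
      then show ?thesis
        using objective_solution_le[OF \<open>0 < K\<close> R2 _ _ deriv dist, of 0] t by simp
    qed
    then show "x t \<in> thin_tube R l"
      using dist[of t] t x_0 x0' by (simp add: thin_tube_def)
  qed
  have sol: "(x has_vector_derivative field K (x t)) (at t within {0..T})" if "t \<in> {0..T}" for t T
  proof -
    have "x t \<in> thin_tube r (l + 1)"
      using in_tube[of t] that r(1) by (auto simp: thin_tube_def)
    then show ?thesis using xT[OF that] g_eq by simp
  qed
  show thesis
  proof
    show "x t \<in> tube_sublevel \<alpha> C f l" if "0 \<le> t" for t
      using in_tube[OF that] R(1) by (auto simp: tube_sublevel_iff thin_tube_def)
    then have F: "antiwindup_field C f K (x t) = {field K (x t)}" if "0 \<le> t" for t
      using antiwindup_field_eq that tube_sublevel_iff by blast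
    show "complete_solution (antiwindup_field C f K) x"
      unfolding complete_solution_def inclusion_solution_def
    proof (intro allI impI conjI)
      fix T :: real assume "0 < T"
      show "absolutely_continuous_on {0..T} x"
        by (rule absolutely_continuous_on_lipschitz, rule lipschitz_from_vector_derivative[OF _ xT])
          (use g_bound in auto)
      show "AE t in lebesgue_on {0..T}. \<exists>v\<in>antiwindup_field C f K (x t).
          (x has_vector_derivative v) (at t within {0..T})"
        by (rule AE_I2) (use F sol in auto)
    qed
  qed (rule x_0)
qed

end

section \<open>Convergence to critical points\<close>

context antiwindup
begin

text \<open>Inside the tube the inclusion is an equation with continuous right-hand side along
  \<open>x\<close>, so the almost-everywhere derivative exists everywhere.\<close>

lemma solution_has_vector_derivative:
  assumes sol: "complete_solution (antiwindup_field C f K) x"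
    and tube: "\<And>t. 0 \<le> t \<Longrightarrow> infdist (x t) C < 1 / (2 * \<alpha>)"
    and t: "t \<in> {0..T}"
  shows "(x has_vector_derivative field K (x t)) (at t within {0..T})"
proof -
  \<comment> \<open>\<open>T\<close> may be 0, whereas \<open>complete_solution\<close> speaks only
    of intervals of positive length.\<close>
  define T' where "T' = T + 1"
  have T': "0 < T'" "t \<in> {0..T'}" using t by (auto simp: T'_def)
  have ac: "absolutely_continuous_on {0..T'} x"
    and ae: "AE t in lebesgue_on {0..T'}. \<exists>v\<in>antiwindup_field C f K (x t).
        (x has_vector_derivative v) (at t within {0..T'})"
    using sol T'(1) by (auto simp: complete_solution_def inclusion_solution_def)
  have "AE t in lebesgue_on {0..T'}. (x has_vector_derivative field K (x t)) (at t within {0..T'})"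
    using ae AE_space
  proof eventually_elim
    case (elim t)
    then have "0 \<le> t" by simp
    then show ?case using elim(1) antiwindup_field_eq[OF tube] by auto
  qed
  moreover have "continuous_on {0..T'} (\<lambda>t. field K (x t))"
    by (rule continuous_on_compose2[OF continuous_on_field absolutely_continuous_imp_continuous_on[OF ac]])
      (use tube in auto)
  ultimately have "(x has_vector_derivative field K (x t)) (at t within {0..T'})"
    by (rule absolutely_continuous_has_vector_derivative[OF ac _ _ T'(2)])
  then show ?thesis
    by (rule has_vector_derivative_within_subset) (simp add: T'_def)
qed

lemma critical_pointI:
  assumes "z \<in> C" "0 < K"
    and "\<And>y. y \<in> C \<Longrightarrow> - (K *\<^sub>R gradient f z) \<bullet> (y - z) \<le> c * (norm (y - z))\<^sup>2"
  shows "z \<in> critical_points C f"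
proof -
  have "- gradient f z \<in> normal_cone C z"
  proof (rule normal_coneI)
    fix y assume "y \<in> C"
    then have "K * (- gradient f z \<bullet> (y - z)) \<le> K * (c / K * (norm (y - z))\<^sup>2)"
      using assms(3)[of y] \<open>0 < K\<close> by simp
    then show "- gradient f z \<bullet> (y - z) \<le> c / K * (norm (y - z))\<^sup>2"
      using \<open>0 < K\<close> by (simp only: mult_le_cancel_left_pos)
  qed
  then have "gradient f z \<in> uminus ` normal_cone C z"
    by (metis image_eqI minus_minus)
  then show ?thesis using \<open>z \<in> C\<close> by (simp add: critical_points_def)
qed

end

section \<open>Long-time behaviour of a confined classical solution\<close>

locale antiwindup_solution = antiwindup C \<alpha> f
  for C :: "'a::euclidean_space set" and \<alpha> f +
  fixes K R l :: real and x :: "real \<Rightarrow> 'a"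
  assumes K: "0 < K" and R: "2 * \<alpha> * R < 1"
    and deriv: "\<And>t T. t \<in> {0..T} \<Longrightarrow> (x has_vector_derivative field K (x t)) (at t within {0..T})"
    and dist_le: "\<And>t. 0 \<le> t \<Longrightarrow> infdist (x t) C \<le> R"
    and value_le: "\<And>t. 0 \<le> t \<Longrightarrow> f (proj C (x t)) \<le> l"
begin

abbreviation p :: "real \<Rightarrow> 'a" where "p t \<equiv> proj C (x t)"

lemma tube: "infdist (x t) C < 1 / (2 * \<alpha>)" if "0 \<le> t"
proof -
  have "R < 1 / (2 * \<alpha>)" using R alpha_pos by (simp add: field_simps)
  then show ?thesis using dist_le[OF that] by simp
qed

lemma p_sublevel:
  assumes "0 \<le> t"
  shows "p t \<in> sublevel_set C f l"
  unfolding sublevel_set_def mem_Collect_eq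
  using assms by (intro conjI proj_in(2) tube value_le)

lemma p_increment:
  assumes "0 \<le> s" "s \<le> t"
  shows "(1 - 2 * \<alpha> * R) * (norm (p t - p s))\<^sup>2 \<le> (t - s) * (f (p s) - f (p t))"
proof (cases "s = t")
  case False
  have "f (p t) + (1 - 2 * \<alpha> * R) * (norm (p t - p s))\<^sup>2 / (t - s) \<le> f (p s)"
    by (rule objective_solution_le[OF K R assms deriv]) (simp_all add: dist_le)
  then show ?thesis using False assms by (simp add: field_simps)
qed simp

lemma f_p_nonincreasing:
  assumes "0 \<le> s" "s \<le> t"
  shows "f (p t) \<le> f (p s)"
proof (cases "s = t")
  case False
  have "0 \<le> (1 - 2 * \<alpha> * R) * (norm (p t - p s))\<^sup>2" using R by simp
  then have "0 \<le> (t - s) * (f (p s) - f (p t))" using p_increment[OF assms] by linarith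
  then show ?thesis using False assms by (simp add: zero_le_mult_iff)
qed simp

text \<open>The objective along \<open>p\<close> is nonincreasing and bounded below by compactness,
  so its remaining drop becomes arbitrarily small; \<open>p_increment\<close> converts this into a
  small displacement over windows of length \<open>\<tau>\<close>.\<close>

lemma p_slowly_varying:
  assumes "0 < \<tau>" "0 < e"
  obtains T0 where "0 \<le> T0" "\<And>s t. \<lbrakk>T0 \<le> s; s \<le> t; t \<le> s + \<tau>\<rbrakk> \<Longrightarrow> norm (p t - p s) < e"
proof -
  let ?c = "1 - 2 * \<alpha> * R"
  let ?V = "(\<lambda>t. f (p t)) ` {0..}"
  have "continuous_on (sublevel_set C f l) f"
    by (rule continuous_on_subset[OF continuous_on_f]) (auto simp: sublevel_set_def)
  then have "bounded (f ` sublevel_set C f l)"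
    using compact_sublevel by (intro compact_imp_bounded compact_continuous_image)
  then have bdd: "bdd_below ?V"
    by (rule bdd_below_mono[OF bounded_imp_bdd_below]) (use p_sublevel in auto)
  define \<eta> where "\<eta> = ?c * e\<^sup>2 / \<tau>"
  have "\<eta> > 0" using assms R by (simp add: \<eta>_def)
  then have "Inf ?V < Inf ?V + \<eta>" by simp
  then have "\<exists>y\<in>?V. y < Inf ?V + \<eta>" using bdd by (subst (asm) cInf_less_iff) auto
  then obtain T0 where T0: "0 \<le> T0" "f (p T0) < Inf ?V + \<eta>" by auto
  have "norm (p t - p s) < e" if "T0 \<le> s" "s \<le> t" "t \<le> s + \<tau>" for s t
  proof -
    have s: "0 \<le> s" using that T0 by simp
    have "f (p s) < Inf ?V + \<eta>" using f_p_nonincreasing[OF T0(1) that(1)] T0(2) by simp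
    moreover have "Inf ?V \<le> f (p t)" using s that by (intro cInf_lower bdd) auto
    ultimately have less: "f (p s) - f (p t) < \<eta>" by simp
    have "?c * (norm (p t - p s))\<^sup>2 \<le> (t - s) * (f (p s) - f (p t))"
      using p_increment[OF s that(2)] .
    also have "\<dots> \<le> \<tau> * (f (p s) - f (p t))"
      using that f_p_nonincreasing[OF s that(2)] by (intro mult_right_mono) auto
    also have "\<dots> < \<tau> * \<eta>" using less \<open>0 < \<tau>\<close> by (rule mult_strict_left_mono)
    also have "\<dots> = ?c * e\<^sup>2" using \<open>0 < \<tau>\<close> by (simp add: \<eta>_def)
    finally have "(norm (p t - p s))\<^sup>2 < e\<^sup>2" using R by simp
    then show ?thesis by (rule power2_less_imp_less) (use \<open>0 < e\<close> in simp)
  qed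
  with T0(1) show thesis by (rule that)
qed

text \<open>The solution relaxes exponentially towards the slowly moving target
  \<open>p t - K *\<^sub>R gradient f (p t)\<close>.\<close>

lemma solution_tendsto:
  assumes t: "filterlim t at_top sequentially" and z: "(\<lambda>n. p (t n)) \<longlonglongrightarrow> z" and "z \<in> C"
  shows "(\<lambda>n::nat. x (t n)) \<longlonglongrightarrow> z - K *\<^sub>R gradient f z"
proof (rule tendstoI)
  fix e :: real assume "0 < e"
  let ?q = "z - K *\<^sub>R gradient f z"
  obtain D where D: "0 < D" "\<And>t. 0 \<le> t \<Longrightarrow> norm (x t - ?q) \<le> D"
  proof -
    obtain B where B: "0 < B" "\<forall>y\<in>sublevel_set C f l. norm y \<le> B"
      using compact_imp_bounded[OF compact_sublevel] unfolding bounded_pos by blast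
    have "norm (x t - ?q) \<le> B + \<bar>R\<bar> + norm ?q" if "0 \<le> t" for t
    proof -
      have "norm (x t - ?q) \<le> norm (x t) + norm ?q" by (rule norm_triangle_ineq4)
      moreover have "norm (x t) \<le> norm (p t) + norm (x t - p t)" by (rule norm_triangle_sub)
      moreover have "norm (p t) \<le> B" using B(2) p_sublevel[OF that] by (rule bspec)
      ultimately show ?thesis
        using proj_in(3)[OF tube[OF that]] dist_le[OF that] by linarith
    qed
    then show thesis using B that[of "B + \<bar>R\<bar> + norm ?q"] by (simp add: add_pos_nonneg)
  qed
  \<comment> \<open>Long enough for the exponential factor to reduce any initial deviation, bounded
    by \<open>D\<close>, to \<open>e / 3\<close>; the maximum with 1 only ensures
    positivity.\<close>
  define \<tau> where "\<tau> = max 1 (- K * ln (e / (3 * D)))"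
  have "0 < \<tau>" by (simp add: \<tau>_def)
  have decay: "exp (- \<tau> / K) * D \<le> e / 3"
  proof -
    have "- K * ln (e / (3 * D)) \<le> \<tau>" by (simp add: \<tau>_def)
    then have "- \<tau> / K \<le> ln (e / (3 * D))" using K by (simp add: field_simps)
    then have "exp (- \<tau> / K) \<le> exp (ln (e / (3 * D)))" by (simp only: exp_le_cancel_iff)
    also have "\<dots> = e / (3 * D)" using \<open>0 < e\<close> D(1) by (intro exp_ln) simp
    finally show ?thesis using D(1) by (simp add: field_simps)
  qed
  have "continuous_on C (\<lambda>y. y - K *\<^sub>R gradient f y)"
    by (intro continuous_intros continuous_on_gradient)
  moreover have "0 < e / 3" using \<open>0 < e\<close> by simp
  ultimately obtain \<delta> where \<delta>: "0 < \<delta>"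
    "\<And>y. y \<in> C \<Longrightarrow> dist y z < \<delta> \<Longrightarrow> dist (y - K *\<^sub>R gradient f y) ?q < e / 3"
    using \<open>z \<in> C\<close> unfolding continuous_on_iff by blast
  obtain T0 where T0: "0 \<le> T0"
    "\<And>s t. \<lbrakk>T0 \<le> s; s \<le> t; t \<le> s + \<tau>\<rbrakk> \<Longrightarrow> norm (p t - p s) < \<delta> / 2"
    using p_slowly_varying[OF \<open>0 < \<tau>\<close>, of "\<delta> / 2"] \<delta>(1) by auto
  have "\<forall>\<^sub>F n in sequentially. T0 + \<tau> \<le> t n"
    using t by (simp add: filterlim_at_top)
  moreover have "\<forall>\<^sub>F n in sequentially. dist (p (t n)) z < \<delta> / 2"
    using z \<delta>(1) by (intro tendstoD) auto
  ultimately show "\<forall>\<^sub>F n in sequentially. dist (x (t n)) ?q < e"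
  proof eventually_elim
    case (elim n)
    \<comment> \<open>On the window from \<open>a\<close> to \<open>t n\<close> the target is within
      \<open>e / 3\<close> of \<open>?q\<close>: half of \<open>\<delta>\<close> covers the slow
      variation of \<open>p\<close>, the other half the distance of \<open>p (t n)\<close> from
      \<open>z\<close>.\<close>
    define a where "a = t n - \<tau>"
    have a: "T0 \<le> a" "a < t n" "0 \<le> a" using elim T0(1) \<open>0 < \<tau>\<close> by (auto simp: a_def)
    have "norm (x (t n) - ?q) \<le> exp (- (t n - a) / K) * norm (x a - ?q) + e / 3"
    proof (rule relaxation_estimate[OF a(2) K])
      fix s assume s: "s \<in> {a..t n}"
      then have "0 \<le> s" using a by simp
      show "(x has_vector_derivative field K (x s)) (at s within {a..t n})"
        by (rule has_vector_derivative_within_subset[OF deriv[of s "t n"]]) (use s a in auto)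
      have "norm (p (t n) - p s) < \<delta> / 2" using s a by (intro T0(2)) (auto simp: a_def)
      then have "dist (p s) z < \<delta>"
        using elim(2) dist_triangle[of "p s" z "p (t n)"] by (simp add: dist_norm norm_minus_commute)
      then have less: "dist (p s - K *\<^sub>R gradient f (p s)) ?q < e / 3"
        using proj_in(2)[OF tube[OF \<open>0 \<le> s\<close>]] by (intro \<delta>(2))
      have eq: "K *\<^sub>R field K (x s) + (x s - ?q) = (p s - K *\<^sub>R gradient f (p s)) - ?q"
        using K by (simp add: field_def algebra_simps)
      show "norm (K *\<^sub>R field K (x s) + (x s - ?q)) \<le> e / 3"
        unfolding eq using less unfolding dist_norm by (rule less_imp_le)
    qed
    also have "exp (- (t n - a) / K) * norm (x a - ?q) \<le> exp (- \<tau> / K) * D"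
      using D(2)[OF a(3)] by (simp add: a_def)
    finally have "norm (x (t n) - ?q) \<le> e / 3 + e / 3" using decay by simp
    then show ?case using \<open>0 < e\<close> by (simp add: dist_norm)
  qed
qed

lemma limit_point_critical:
  assumes t: "filterlim t at_top sequentially" and z: "(\<lambda>n::nat. p (t n)) \<longlonglongrightarrow> z"
  shows "z \<in> critical_points C f"
proof -
  have ev: "\<forall>\<^sub>F n in sequentially. 0 \<le> t n" using t by (simp add: filterlim_at_top)
  then have "\<forall>\<^sub>F n in sequentially. p (t n) \<in> C"
    by eventually_elim (rule proj_in(2)[OF tube])
  then have "z \<in> C"
    using closed_C z by (intro Lim_in_closed_set[OF _ _ sequentially_bot])
  show ?thesis
  proof (rule critical_pointI[OF \<open>z \<in> C\<close> K])
    fix y assume "y \<in> C"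
    \<comment> \<open>The residual converges to \<open>- (K *\<^sub>R gradient f z)\<close>, so the
      limit of the proximal inequalities is the hypothesis of
      \<open>critical_pointI\<close>.\<close>
    have "(\<lambda>n. (x (t n) - p (t n)) \<bullet> (y - p (t n))) \<longlonglongrightarrow> (z - K *\<^sub>R gradient f z - z) \<bullet> (y - z)"
      by (intro tendsto_intros solution_tendsto[OF t z \<open>z \<in> C\<close>] z)
    moreover have "(\<lambda>n. \<alpha> * R * (norm (y - p (t n)))\<^sup>2) \<longlonglongrightarrow> \<alpha> * R * (norm (y - z))\<^sup>2"
      by (intro tendsto_intros z)
    moreover have "\<forall>\<^sub>F n in sequentially.
        (x (t n) - p (t n)) \<bullet> (y - p (t n)) \<le> \<alpha> * R * (norm (y - p (t n)))\<^sup>2"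
      using ev
    proof eventually_elim
      case (elim n)
      have "(x (t n) - p (t n)) \<bullet> (y - p (t n)) \<le> \<alpha> * infdist (x (t n)) C * (norm (y - p (t n)))\<^sup>2"
        by (rule proj_set_prox[OF proj_in(1)[OF tube[OF elim]] \<open>y \<in> C\<close>])
      also have "\<dots> \<le> \<alpha> * R * (norm (y - p (t n)))\<^sup>2"
        using dist_le[OF elim] alpha_pos by (intro mult_right_mono mult_left_mono) auto
      finally show ?case .
    qed
    ultimately have "(z - K *\<^sub>R gradient f z - z) \<bullet> (y - z) \<le> \<alpha> * R * (norm (y - z))\<^sup>2"
      by (intro tendsto_le[OF sequentially_bot])
    then show "- (K *\<^sub>R gradient f z) \<bullet> (y - z) \<le> \<alpha> * R * (norm (y - z))\<^sup>2" by simp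
  qed
qed

lemma critical_subsequence:
  assumes "\<And>n::nat. real n \<le> t n"
  obtains z r where "z \<in> critical_points C f" "strict_mono (r :: nat \<Rightarrow> nat)"
    "(\<lambda>n. p (t (r n))) \<longlonglongrightarrow> z"
proof -
  have "p (t n) \<in> sublevel_set C f l" for n
    using assms[of n] by (intro p_sublevel) linarith
  then obtain z r where r: "strict_mono r" and z: "((\<lambda>n. p (t n)) \<circ> r) \<longlonglongrightarrow> z"
    using compact_sublevel[of l] unfolding compact_def by meson
  have "filterlim t at_top sequentially"
    using assms by (intro filterlim_at_top_mono[OF filterlim_real_sequentially]) auto
  then have "filterlim (\<lambda>n. t (r n)) at_top sequentially"
    using r filterlim_subseq filterlim_compose by blast
  then show thesis
    using that[OF limit_point_critical r] z by (simp add: o_def)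
qed

text \<open>Times at which \<open>p\<close> stays a fixed distance away from the critical set would
  have a subsequence along which \<open>p\<close> converges to a critical point. Sampling at the
  integers already shows that critical points exist.\<close>

lemma converges_to_critical_points: "converges_to_set (projected_trajectory C x) (critical_points C f)"
  unfolding converges_to_set_def
proof
  show "critical_points C f \<noteq> {}"
    using critical_subsequence[of real] by blast
  show "((\<lambda>t. infdist (projected_trajectory C x t) (critical_points C f)) \<longlongrightarrow> 0) at_top"
  proof (rule ccontr)
    assume "\<not> ?thesis"
    then obtain e where e: "0 < e"
      "\<not> (\<forall>\<^sub>F t in at_top. dist (infdist (projected_trajectory C x t) (critical_points C f)) 0 < e)"
      unfolding tendsto_iff by blast
    then have "\<forall>N. \<exists>t\<ge>N. e \<le> infdist (p t) (critical_points C f)"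
      unfolding eventually_at_top_linorder projected_trajectory_def proj_def[symmetric]
      by (auto simp: not_less infdist_nonneg)
    then have "\<forall>n::nat. \<exists>t. real n \<le> t \<and> e \<le> infdist (p t) (critical_points C f)"
      by blast
    from choice[OF this]
    obtain t where t: "\<And>n::nat. real n \<le> t n" "\<And>n. e \<le> infdist (p (t n)) (critical_points C f)"
      by blast
    obtain z r where z: "z \<in> critical_points C f" and lim: "(\<lambda>n::nat. p (t (r n))) \<longlonglongrightarrow> z"
      using critical_subsequence[OF t(1)] by blast
    have "\<forall>\<^sub>F n in sequentially. dist (p (t (r n))) z < e"
      using lim e(1) by (rule tendstoD)
    then obtain n where "dist (p (t (r n))) z < e"
      by (auto simp: eventually_sequentially)
    then show False
      using t(2)[of "r n"] infdist_le[OF z, of "p (t (r n))"] by simp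
  qed
qed

end

section \<open>Convergence of arbitrary solutions and choice of the gain\<close>

context antiwindup
begin

text \<open>Membership in the open tube does not bound the distance uniformly below the critical
  radius; the inward-pointing estimate supplies such a bound \<open>R\<close> from the initial
  distance and \<open>K * M\<close>.\<close>

lemma solution_converges:
  assumes "0 < K" "K * M < 1 / (2 * \<alpha>)"
    and M: "\<And>p. p \<in> C \<Longrightarrow> f p \<le> l \<Longrightarrow> norm (gradient f p) \<le> M"
    and sol: "complete_solution (antiwindup_field C f K) x"
    and tube: "\<And>t. 0 \<le> t \<Longrightarrow> x t \<in> tube_sublevel \<alpha> C f l"
  shows "converges_to_set (projected_trajectory C x) (critical_points C f)"
proof -
  have d: "infdist (x t) C < 1 / (2 * \<alpha>)" and l: "f (proj C (x t)) \<le> l" if "0 \<le> t" for t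
    using tube[OF that] by (auto simp: tube_sublevel_iff)
  define R where "R = max (infdist (x 0) C) ((K * M + 1 / (2 * \<alpha>)) / 2)"
  have R: "R < 1 / (2 * \<alpha>)" "K * M < R" "infdist (x 0) C \<le> R"
    using max_midpoint_bounds[OF d[of 0] assms(2)] by (simp_all add: R_def)
  have deriv: "(x has_vector_derivative field K (x t)) (at t within {0..T})" if "t \<in> {0..T}" for t T
    using sol d that by (rule solution_has_vector_derivative)
  have dist: "infdist (x t) C \<le> R" if "0 \<le> t" for t
  proof (rule infdist_solution_le[OF \<open>0 < K\<close> R(2) deriv d _ R(3), of t])
    show "norm (gradient f (proj C (x s))) \<le> M" if "s \<in> {0..t}" for s
      using that by (intro M proj_in(2) d l) auto
  qed (use that in auto)
  have R2: "2 * \<alpha> * R < 1" using R(1) alpha_pos by (simp add: field_simps)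
  interpret antiwindup_solution C \<alpha> f K R l x
    by unfold_locales (fact \<open>0 < K\<close> R2 deriv dist l)+
  show ?thesis by (rule converges_to_critical_points)
qed

end

theorem theorem2:
  fixes C :: "(real ^ 'n) set"
    and \<Phi> :: "real ^ 'n \<Rightarrow> real"
    and \<alpha> l :: real
  assumes "0 < \<alpha>"
    and "prox_regular \<alpha> C"
    and "continuously_differentiable_near C \<Phi>"
    and "\<And>l'. compact (sublevel_set C \<Phi> l')"
  shows "\<exists>Kstar>0. \<forall>K. 0 < K \<and> K < Kstar \<longrightarrow>
           (\<forall>x0 \<in> tube_sublevel \<alpha> C \<Phi> l.
              (\<exists>x. complete_solution (antiwindup_field C \<Phi> K) x \<and> x 0 = x0 \<and>
                   (\<forall>t\<ge>0. x t \<in> tube_sublevel \<alpha> C \<Phi> l)) \<and>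
              (\<forall>x. complete_solution (antiwindup_field C \<Phi> K) x \<and> x 0 = x0 \<and>
                   (\<forall>t\<ge>0. x t \<in> tube_sublevel \<alpha> C \<Phi> l) \<longrightarrow>
                   converges_to_set (projected_trajectory C x) (critical_points C \<Phi>)))"
proof (cases "C = {}")
  case True
  \<comment> \<open>With no initial conditions every positive threshold will do; the locales require
    a nonempty set.\<close>
  then have "tube_sublevel \<alpha> C \<Phi> l = {}" by (simp add: tube_sublevel_def open_tube_def)
  then show ?thesis by (intro exI[of _ 1]) simp
next
  case False
  interpret antiwindup C \<alpha> \<Phi>
    using assms False by unfold_locales
  \<comment> \<open>The level \<open>l + 1\<close> supplies the slack used in the existence proof;
    convergence needs the bound only up to \<open>l\<close>.\<close>
  obtain M where M: "0 < M" "\<And>p. p \<in> C \<Longrightarrow> \<Phi> p \<le> l + 1 \<Longrightarrow> norm (gradient \<Phi> p) \<le> M"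
    using gradient_bound by blast
  show ?thesis
  proof (intro exI[of _ "1 / (2 * \<alpha> * M)"] conjI allI impI ballI)
    \<comment> \<open>The threshold expresses \<open>K * M < 1 / (2 * \<alpha>)\<close>: the
      distance at which the field surely points inward lies inside the tube.\<close>
    show "0 < 1 / (2 * \<alpha> * M)" using \<open>0 < \<alpha>\<close> M(1) by simp
    fix K x0 assume K: "0 < K \<and> K < 1 / (2 * \<alpha> * M)" and x0: "x0 \<in> tube_sublevel \<alpha> C \<Phi> l"
    then have KM: "K * M < 1 / (2 * \<alpha>)" using \<open>0 < \<alpha>\<close> M(1) by (simp add: field_simps)
    show "\<exists>x. complete_solution (antiwindup_field C \<Phi> K) x \<and> x 0 = x0 \<and>
        (\<forall>t\<ge>0. x t \<in> tube_sublevel \<alpha> C \<Phi> l)"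
      using complete_solution_exists[OF _ KM M(2) x0] K by blast
    fix x assume "complete_solution (antiwindup_field C \<Phi> K) x \<and> x 0 = x0 \<and>
        (\<forall>t\<ge>0. x t \<in> tube_sublevel \<alpha> C \<Phi> l)"
    then show "converges_to_set (projected_trajectory C x) (critical_points C \<Phi>)"
      using K KM M(2) by (intro solution_converges[of K M l x]) auto
  qed
qed

end
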